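(* Let $G=(V,E)$ be a Cayley graph of a finitely generated amenable group and let $\#\in\{A,D,N\}$. Suppose there are a sequence $(G'_n)_n$ of finite connected subgraphs of $G$ and a sequence $(c_n)_n$ of positive reals such that (i) $\lim_{n\to\infty}|G'_n|=\infty$, (ii) $\lim_{n\to\infty}c_n=0$, and (iii) $\lambda^{\#}(G'_n)\le c_n$ for all $n$. For $E>0$ small enough set $n(E)=\min\{n: c_n\le E\}$. Consider independent site or independent bond percolation on $G$ with parameter $p$. Then for every $0<p<1$ there is a constant $b_p>0$ such that for all $E>0$ small enough $$N^{\#}(E)-N^{\#}(0)\ge e^{-b_p|G'_{n(E)}|}.$$
   Context: $G$ is the Cayley graph with respect to a finite symmetric generating set $S$ not containing the identity $\iota$; $k=|S|$. For a subgraph $G'=(V',E')$, $|G'|$ is its number of vertices, $d_{G'}(x)$ its vertex degrees, and on $\ell^2(V')$: $(D(G')\varphi)(x)=d_{G'}(x)\varphi(x)$, $(A(G')\varphi)(x)=\sum_{y\in V',y\sim_{G'}x}\varphi(y)$, $\Delta^A(G')=k\,\mathrm{Id}-A(G')$, $\Delta^D(G')=2k\,\mathrm{Id}-D(G')-A(G')$, $\Delta^N(G')=D(G')-A(G')$. For finite $G'$, $\lambda^{\#}(G')$ denotes the lowest non-zero eigenvalue of $\Delta^{\#}(G')$. Site percolation: vertices open independently with probability $p$, $G(\omega)$ the induced subgraph on open vertices; bond percolation: edges open independently with probability $p$, $G(\omega)$ consisting of open edges and their endpoints. $\Delta^{\#}_\omega=\Delta^{\#}(G(\omega))$ on $\ell^2(V(\omega))$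 and $N^{\#}(E)=\mathbb{E}\{\langle\chi_{(-\infty,E]}(\Delta^{\#}_\omega)\delta_\iota,\delta_\iota\rangle\}$, with the inner product taken as $0$ if $\iota\notin V(\omega)$. *)

theory Defs
  imports "HOL-Probability.Probability" "HOL-Algebra.Generated_Groups" "HOL-Algebra.Coset"
begin

section \<open>Groups, Cayley graphs, amenability\<close>

definition fin_gen_set :: "('a, 'b) monoid_scheme \<Rightarrow> 'a set \<Rightarrow> bool" where
  "fin_gen_set G S \<longleftrightarrow> finite S \<and> S \<subseteq> carrier G \<and> \<one>\<^bsub>G\<^esub> \<notin> S
      \<and> (\<forall>s\<in>S. inv\<^bsub>G\<^esub> s \<in> S) \<and> generate G S = carrier G"

text \<open>Amenability of a discrete group via the Foelner condition.\<close>
definition amenable :: "('a, 'b) monoid_scheme \<Rightarrow> bool" where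
  "amenable G \<longleftrightarrow> (\<forall>F \<epsilon>. finite F \<and> F \<subseteq> carrier G \<and> \<epsilon> > (0::real) \<longrightarrow>
     (\<exists>K. finite K \<and> K \<noteq> {} \<and> K \<subseteq> carrier G \<and>
        (\<forall>g\<in>F. real (card (((g <#\<^bsub>G\<^esub> K) - K) \<union> (K - (g <#\<^bsub>G\<^esub> K)))) < \<epsilon> * real (card K))))"

text \<open>Cayley graph adjacency: x ~ y iff y = x s for some s in S.\<close>
definition cay :: "('a, 'b) monoid_scheme \<Rightarrow> 'a set \<Rightarrow> 'a \<Rightarrow> 'a \<Rightarrow> bool" where
  "cay G S x y \<longleftrightarrow> x \<in> carrier G \<and> y \<in> carrier G \<and> (\<exists>s\<in>S. y = x \<otimes>\<^bsub>G\<^esub> s)"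

definition cay_edges :: "('a, 'b) monoid_scheme \<Rightarrow> 'a set \<Rightarrow> 'a set set" where
  "cay_edges G S = {{x, y} | x y. cay G S x y}"

section \<open>Finite subgraphs\<close>

text \<open>A subgraph is a pair (V', E') of a vertex set and a set of (2-element) edges.\<close>
definition subgraph :: "('a, 'b) monoid_scheme \<Rightarrow> 'a set \<Rightarrow> 'a set \<times> 'a set set \<Rightarrow> bool" where
  "subgraph G S H \<longleftrightarrow> fst H \<subseteq> carrier G \<and> snd H \<subseteq> cay_edges G S \<and> (\<forall>e\<in>snd H. e \<subseteq> fst H)"

definition sg_adj :: "'a set \<times> 'a set set \<Rightarrow> 'a \<Rightarrow> 'a \<Rightarrow> bool" where
  "sg_adj H x y \<longleftrightarrow> {x, y} \<in> snd H"

definition connected_graph :: "'a set \<times> 'a set set \<Rightarrow> bool" where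
  "connected_graph H \<longleftrightarrow> fst H \<noteq> {} \<and>
     (\<forall>x\<in>fst H. \<forall>y\<in>fst H. (x, y) \<in> {(u, v). sg_adj H u v}\<^sup>*)"

definition finite_connected_subgraph :: "('a, 'b) monoid_scheme \<Rightarrow> 'a set \<Rightarrow> 'a set \<times> 'a set set \<Rightarrow> bool" where
  "finite_connected_subgraph G S H \<longleftrightarrow> subgraph G S H \<and> finite (fst H) \<and> connected_graph H"

section \<open>Laplacians on a graph given by a vertex set W and adjacency relation adj\<close>

datatype lap_type = LapA | LapD | LapN

definition gdeg :: "'a set \<Rightarrow> ('a \<Rightarrow> 'a \<Rightarrow> bool) \<Rightarrow> 'a \<Rightarrow> real" where
  "gdeg W adj x = real (card {y\<in>W. adj x y})"

definition adjop :: "'a set \<Rightarrow> ('a \<Rightarrow> 'a \<Rightarrow> bool) \<Rightarrow> ('a \<Rightarrow> real) \<Rightarrow> 'a \<Rightarrow> real" where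
  "adjop W adj \<phi> x = (\<Sum>y\<in>{y\<in>W. adj x y}. \<phi> y)"

text \<open>The operators on functions supported on W (values outside W are set to 0); k = |S|.\<close>
definition lapop :: "lap_type \<Rightarrow> nat \<Rightarrow> 'a set \<Rightarrow> ('a \<Rightarrow> 'a \<Rightarrow> bool) \<Rightarrow> ('a \<Rightarrow> real) \<Rightarrow> 'a \<Rightarrow> real" where
  "lapop t k W adj \<phi> x =
     (if x \<in> W then
        (case t of
           LapA \<Rightarrow> real k * \<phi> x - adjop W adj \<phi> x
         | LapD \<Rightarrow> (2 * real k - gdeg W adj x) * \<phi> x - adjop W adj \<phi> x
         | LapN \<Rightarrow> gdeg W adj x * \<phi> x - adjop W adj \<phi> x)
      else 0)"

definition is_eigenvalue :: "lap_type \<Rightarrow> nat \<Rightarrow> 'a set \<Rightarrow> ('a \<Rightarrow> 'a \<Rightarrow> bool) \<Rightarrow> real \<Rightarrow> bool" where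
  "is_eigenvalue t k W adj eval \<longleftrightarrow>
     (\<exists>\<phi>. (\<exists>x\<in>W. \<phi> x \<noteq> 0) \<and> (\<forall>x\<in>W. lapop t k W adj \<phi> x = eval * \<phi> x))"

text \<open>Lowest non-zero eigenvalue of the Laplacian of a finite subgraph.\<close>
definition lowest_nonzero_eig :: "lap_type \<Rightarrow> nat \<Rightarrow> 'a set \<times> 'a set set \<Rightarrow> real" where
  "lowest_nonzero_eig t k H = Inf {eval. eval \<noteq> 0 \<and> is_eigenvalue t k (fst H) (sg_adj H) eval}"

section \<open>Spectral measure and integrated density of states\<close>

text \<open>Spectral measure of the vector delta_x for the (bounded, self-adjoint) Laplacian on l^2(W):
  the unique compactly supported finite Borel measure whose moments are the diagonal
  matrix elements of the powers of the operator.\<close>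
definition spectral_measure :: "lap_type \<Rightarrow> nat \<Rightarrow> 'a set \<Rightarrow> ('a \<Rightarrow> 'a \<Rightarrow> bool) \<Rightarrow> 'a \<Rightarrow> real measure" where
  "spectral_measure t k W adj x = (THE \<mu>. sets \<mu> = sets borel \<and> finite_measure \<mu> \<and>
      (\<exists>R. emeasure \<mu> (- {-R..R}) = 0) \<and>
      (\<forall>m::nat. (\<integral>s. s ^ m \<partial>\<mu>) = ((lapop t k W adj ^^ m) (indicator {x})) x))"

datatype perc_type = Site | Bond

definition site_W :: "('a, 'b) monoid_scheme \<Rightarrow> ('a \<Rightarrow> bool) \<Rightarrow> 'a set" where
  "site_W G \<omega> = {x\<in>carrier G. \<omega> x}"

definition site_adj :: "('a, 'b) monoid_scheme \<Rightarrow> 'a set \<Rightarrow> ('a \<Rightarrow> bool) \<Rightarrow> 'a \<Rightarrow> 'a \<Rightarrow> bool" where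
  "site_adj G S \<omega> x y \<longleftrightarrow> cay G S x y \<and> \<omega> x \<and> \<omega> y"

definition bond_adj :: "('a, 'b) monoid_scheme \<Rightarrow> 'a set \<Rightarrow> ('a set \<Rightarrow> bool) \<Rightarrow> 'a \<Rightarrow> 'a \<Rightarrow> bool" where
  "bond_adj G S \<omega> x y \<longleftrightarrow> cay G S x y \<and> \<omega> {x, y}"

definition bond_W :: "('a, 'b) monoid_scheme \<Rightarrow> 'a set \<Rightarrow> ('a set \<Rightarrow> bool) \<Rightarrow> 'a set" where
  "bond_W G S \<omega> = {x. \<exists>y. bond_adj G S \<omega> x y}"

definition site_perc :: "('a, 'b) monoid_scheme \<Rightarrow> real \<Rightarrow> ('a \<Rightarrow> bool) measure" where
  "site_perc G p = PiM (carrier G) (\<lambda>_. measure_pmf (bernoulli_pmf p))"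

definition bond_perc :: "('a, 'b) monoid_scheme \<Rightarrow> 'a set \<Rightarrow> real \<Rightarrow> ('a set \<Rightarrow> bool) measure" where
  "bond_perc G S p = PiM (cay_edges G S) (\<lambda>_. measure_pmf (bernoulli_pmf p))"

text \<open>Integrated density of states N(E) = E[<chi_(-inf,E](Delta_omega) delta_1, delta_1>],
  with the inner product taken as 0 if the identity is not a vertex of G(omega).\<close>
definition IDS :: "perc_type \<Rightarrow> lap_type \<Rightarrow> ('a, 'b) monoid_scheme \<Rightarrow> 'a set \<Rightarrow> real \<Rightarrow> real \<Rightarrow> real" where
  "IDS pt t G S p E = (case pt of
     Site \<Rightarrow> (\<integral>\<omega>. (if \<one>\<^bsub>G\<^esub> \<in> site_W G \<omega>
               then measure (spectral_measure t (card S) (site_W G \<omega>) (site_adj G S \<omega>) \<one>\<^bsub>G\<^esub>) {..E}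
               else 0) \<partial>site_perc G p)
   | Bond \<Rightarrow> (\<integral>\<omega>. (if \<one>\<^bsub>G\<^esub> \<in> bond_W G S \<omega>
               then measure (spectral_measure t (card S) (bond_W G S \<omega>) (bond_adj G S \<omega>) \<one>\<^bsub>G\<^esub>) {..E}
               else 0) \<partial>bond_perc G S p))"

end

theory Submission
  imports Defs "HOL-Real_Asymp.Real_Asymp"
begin

text \<open>
  If a finite vertex set \<open>K\<close> carries, in the induced subgraph, an eigenvector with eigenvalue in
  \<open>(0, E]\<close>, then a translate of \<open>K\<close> that puts a maximum of the eigenvector at the identity is the
  percolation cluster of the identity with probability at least \<open>(min p (1 - p)) ^ ((|S| + 1) |K|)\<close>,
  and on that event the spectral measure has an atom of mass at least \<open>1 / |K|\<close> in \<open>(0, E]\<close>.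
  For the Laplacians A and D take \<open>K = V(G'\<^sub>n)\<close>: passing to the induced graph only adds edges,
  which lowers the smallest eigenvalue, and this eigenvalue is positive because the group is infinite.
  In the Neumann case adding edges may raise the spectral gap. There every non-zero eigenvalue of a
  connected graph on \<open>n\<close> vertices is at least \<open>1 / (2 n\<^sup>2)\<close>, so an induced path with \<open>6 n\<close> vertices,
  namely a geodesic, has a non-zero eigenvalue at most that of \<open>G'\<^sub>n\<close>.

  The spectral measure exists and is unique as the solution of a Hausdorff moment problem whose data
  are polynomials in finitely many percolation variables. Its distribution function is therefore a
  limit of measurable functions of the configuration.
\<close>

section \<open>The moment functional of a sequence\<close>

text \<open>A site percolation cluster always carries all Cayley edges between its vertices, so the
  given \<open>G'_n\<close> may never occur as one. Both models are therefore treated with vertex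
  sets \<open>K\<close> and their induced edges, and what has to be controlled is the effect of the
  added edges on the eigenvalue. The growing sizes force the group to be infinite, which gives
  positivity for A and D as well as geodesics of every length. Small \<open>E\<close> makes
  \<open>|G'_{n(E)}| >= 2\<close>; then \<open>K\<close> has no isolated vertex, as the vertex set
  of bond percolation demands, and a non-zero Neumann eigenvalue exists. The factor 6 comes from
  comparing the bound \<open>pi^2 / L^2\<close> for a path with \<open>L\<close> vertices to
  \<open>1 / (2 n^2)\<close>. Since \<open>spectral_measure\<close> is a definite description by
  moments, the argument works with moments throughout: a moment of order \<open>i\<close> sees only
  the ball of radius \<open>i\<close>, so positivity is a finite computation even when the
  configuration is infinite.\<close>

definition mfun :: "(nat \<Rightarrow> real) \<Rightarrow> real poly \<Rightarrow> real" where
  "mfun m p = (\<Sum>i\<le>degree p. coeff p i * m i)"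

lemma mfun_altdef:
  assumes "degree p \<le> n"
  shows "mfun m p = (\<Sum>i\<le>n. coeff p i * m i)"
  unfolding mfun_def
  by (rule sum.mono_neutral_left) (use assms in \<open>auto simp: coeff_eq_0\<close>)

lemma mfun_0 [simp]: "mfun m 0 = 0"
  by (simp add: mfun_def)

lemma mfun_add: "mfun m (p + q) = mfun m p + mfun m q"
proof -
  define n where "n = max (degree p) (degree q)"
  have "degree (p + q) \<le> n" "degree p \<le> n" "degree q \<le> n"
    by (auto simp: n_def degree_add_le_max)
  then show ?thesis
    by (simp add: mfun_altdef sum.distrib algebra_simps)
qed

lemma mfun_smult: "mfun m (smult a p) = a * mfun m p"
proof -
  have "mfun m (smult a p) = (\<Sum>i\<le>degree p. coeff (smult a p) i * m i)"
    by (rule mfun_altdef) (rule degree_smult_le)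
  then show ?thesis by (simp add: mfun_def sum_distrib_left mult.assoc)
qed

lemma mfun_sum: "mfun m (\<Sum>i\<in>A. f i) = (\<Sum>i\<in>A. mfun m (f i))"
  by (induction A rule: infinite_finite_induct) (auto simp: mfun_add)

lemma mfun_monom: "mfun m (monom a n) = a * m n"
proof -
  have "mfun m (monom a n) = (\<Sum>i\<le>n. coeff (monom a n) i * m i)"
    by (rule mfun_altdef) (rule degree_monom_le)
  also have "\<dots> = (\<Sum>i\<le>n. if i = n then a * m n else 0)"
    by (intro sum.cong) auto
  finally show ?thesis by simp
qed

lemma mfun_mult:
  "mfun m (p * q) = (\<Sum>i\<le>degree p. \<Sum>j\<le>degree q. coeff p i * coeff q j * m (i + j))"
proof -
  have "p * q = (\<Sum>i\<le>degree p. monom (coeff p i) i) * (\<Sum>j\<le>degree q. monom (coeff q j) j)"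
    by (simp add: poly_as_sum_of_monoms)
  also have "\<dots> = (\<Sum>i\<le>degree p. \<Sum>j\<le>degree q. monom (coeff p i * coeff q j) (i + j))"
    by (simp add: sum_product mult_monom)
  finally show ?thesis by (simp add: mfun_sum mfun_monom)
qed

lemma mfun_X_mult:
  "mfun m ([:0, 1:] * p * q) = (\<Sum>i\<le>degree p. \<Sum>j\<le>degree q. coeff p i * coeff q j * m (Suc (i + j)))"
proof -
  have "[:0, 1:] = monom (1::real) 1" by (simp add: monom_altdef)
  then have "[:0, 1:] * p * q =
      monom 1 1 * ((\<Sum>i\<le>degree p. monom (coeff p i) i) * (\<Sum>j\<le>degree q. monom (coeff q j) j))"
    by (simp only: poly_as_sum_of_monoms mult.assoc)
  also have "\<dots> = monom 1 1 * (\<Sum>i\<le>degree p. \<Sum>j\<le>degree q. monom (coeff p i * coeff q j) (i + j))"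
    by (simp only: sum_product mult_monom)
  also have "\<dots> = (\<Sum>i\<le>degree p. \<Sum>j\<le>degree q. monom (coeff p i * coeff q j) (Suc (i + j)))"
    by (simp add: sum_distrib_left mult_monom)
  finally show ?thesis by (simp add: mfun_sum mfun_monom)
qed

text \<open>These conditions hold for the moments \<open>\<langle>T\<^sup>i v, v\<rangle>\<close> of a symmetric operator with \<open>0 \<le> T \<le> C\<close>.\<close>
definition moments_on :: "real \<Rightarrow> (nat \<Rightarrow> real) \<Rightarrow> bool" where
  "moments_on C m \<longleftrightarrow> (\<forall>q. mfun m (q * q) \<ge> 0 \<and> mfun m ([:0, 1:] * q * q) \<ge> 0
      \<and> mfun m ([:C, -1:] * q * q) \<ge> 0)"

text \<open>Up to positive factors these are the Bernstein polynomials of [0, C], so this is what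
  makes the Bernstein weights non-negative. Splitting off squares leaves each exponent equal to 0 or
  1.\<close>

lemma moments_on_basis_nonneg:
  assumes "moments_on C m" "C > 0"
  shows "mfun m ([:0, 1:] ^ i * [:C, -1:] ^ j) \<ge> 0"
proof -
  let ?a = "[:0, 1:] :: real poly" and ?b = "[:C, -1:]"
  have sq: "mfun m (q * q) \<ge> 0" "mfun m (?a * q * q) \<ge> 0" "mfun m (?b * q * q) \<ge> 0" for q
    using assms(1) unfolding moments_on_def by blast+
  define q where "q = ?a ^ (i div 2) * ?b ^ (j div 2)"
  \<comment> \<open>When both exponents are odd, multiply by \<open>C = X + (C - X)\<close> to reach the pure square cases.\<close>
  have ab: "smult C 1 = ?a + ?b" by simp
  have half: "n mod 2 + n div 2 + n div 2 = n" for n :: nat by presburger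
  have i: "?a ^ i = ?a ^ (i mod 2) * ?a ^ (i div 2) * ?a ^ (i div 2)"
    by (simp only: half flip: power_add)
  have j: "?b ^ j = ?b ^ (j mod 2) * ?b ^ (j div 2) * ?b ^ (j div 2)"
    by (simp only: half flip: power_add)
  have eq: "?a ^ i * ?b ^ j = ?a ^ (i mod 2) * ?b ^ (j mod 2) * q * q"
    unfolding q_def by (subst i, subst j) (simp only: ac_simps)
  consider "i mod 2 = 0" "j mod 2 = 0" | "i mod 2 = 1" "j mod 2 = 0"
    | "i mod 2 = 0" "j mod 2 = 1" | "i mod 2 = 1" "j mod 2 = 1"
    by linarith
  then show ?thesis
  proof cases
    case 4
    have "smult C (?a * ?b * q * q) = smult C 1 * (?a * ?b * q * q)" by simp
    also have "\<dots> = ?b * (?a * q) * (?a * q) + ?a * (?b * q) * (?b * q)"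
      unfolding ab by (simp only: algebra_simps)
    finally have "C * mfun m (?a * ?b * q * q) = mfun m \<dots>"
      by (simp only: mfun_smult [symmetric])
    then have "C * 0 \<le> C * mfun m (?a * ?b * q * q)"
      using sq(2)[of "?b * q"] sq(3)[of "?a * q"] by (simp only: mfun_add mult_zero_right)
    then show ?thesis
      unfolding eq 4 power_one_right mult_le_cancel_left_pos[OF \<open>C > 0\<close>] .
  qed (use sq[of q] in \<open>simp_all only: eq power_0 power_one_right mult_1_left mult_1_right\<close>)
qed

text \<open>The factorial moments of a binomial distribution: (n choose j)(j choose r) = (n choose
  r)(n - r choose j - r), and a binomial expansion remains. The setting is a commutative ring
  because \<open>x\<close> and \<open>y\<close> will be the polynomials X and C - X.\<close>

lemma binomial_moment_identity:
  fixes x y :: "'a :: comm_ring_1"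
  assumes "r \<le> n"
  shows "(\<Sum>j\<le>n. of_nat ((j choose r) * (n choose j)) * (x ^ j * y ^ (n - j))) =
     of_nat (n choose r) * x ^ r * (x + y) ^ (n - r)"
proof -
  have "(\<Sum>j\<le>n. of_nat ((j choose r) * (n choose j)) * (x ^ j * y ^ (n - j))) =
        (\<Sum>j\<in>{r..n}. of_nat ((j choose r) * (n choose j)) * (x ^ j * y ^ (n - j)))"
    by (rule sum.mono_neutral_right) (auto simp: binomial_eq_0)
  also have "\<dots> = (\<Sum>i\<le>n - r. of_nat (((i + r) choose r) * (n choose (i + r))) * (x ^ (i + r) * y ^ (n - (i + r))))"
    by (rule sum.reindex_bij_witness [of _ "\<lambda>i. i + r" "\<lambda>j. j - r"]) (use assms in auto)
  also have "\<dots> = (\<Sum>i\<le>n - r. of_nat (n choose r) * x ^ r * (of_nat ((n - r) choose i) * x ^ i * y ^ (n - r - i)))"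
  proof (rule sum.cong)
    fix i assume "i \<in> {..n - r}"
    then have "i + r \<le> n" using assms by auto
    then have "(n choose (i + r)) * ((i + r) choose r) = (n choose r) * ((n - r) choose i)"
      using choose_mult[of r "i + r" n] by simp
    then have "of_nat (((i + r) choose r) * (n choose (i + r))) =
        (of_nat (n choose r) * of_nat ((n - r) choose i) :: 'a)"
      by (metis mult.commute of_nat_mult)
    moreover have "n - (i + r) = n - r - i" by simp
    ultimately show "of_nat (((i + r) choose r) * (n choose (i + r))) * (x ^ (i + r) * y ^ (n - (i + r)))
      = of_nat (n choose r) * x ^ r * (of_nat ((n - r) choose i) * x ^ i * y ^ (n - r - i))"
      by (simp only: power_add ac_simps)
  qed simp
  also have "\<dots> = of_nat (n choose r) * x ^ r * (x + y) ^ (n - r)"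
    by (simp only: binomial_ring sum_distrib_left)
  finally show ?thesis .
qed

text \<open>Leads from factorial moments, which the Bernstein weights reproduce exactly, to power
  moments with an error O(1/n) uniform in \<open>j\<close>. The quotient is a product of
  \<open>r\<close> factors (j - i)/(n - i), each close to j/n. The condition
  \<open>2 * r < n\<close> keeps the factors with j < i above -1, so that the difference of the
  products is at most the sum of the differences.\<close>

lemma choose_quotient_approx:
  assumes "2 * r < n" "j \<le> n"
  shows "\<bar>real (j choose r) / real (n choose r) - (real j / real n) ^ r\<bar> \<le> real r * (real r / (real n - real r))"
proof -
  have "real (j choose r) / real (n choose r) = (\<Prod>i=0..<r. (real j - real i) / (real n - real i))"
    by (simp add: binomial_gbinomial gbinomial_prod_rev prod_dividef)
  then have "\<bar>real (j choose r) / real (n choose r) - (real j / real n) ^ r\<bar> =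
      norm ((\<Prod>i=0..<r. (real j - real i) / (real n - real i)) - (\<Prod>i=0..<r. real j / real n))"
    by simp
  also have "\<dots> \<le> (\<Sum>i=0..<r. norm ((real j - real i) / (real n - real i) - real j / real n))"
  proof (rule norm_prod_diff)
    fix i assume "i \<in> {0..<r}"
    then show "norm ((real j - real i) / (real n - real i)) \<le> 1"
      using assms by (auto simp: field_simps)
    show "norm (real j / real n) \<le> 1" using assms by auto
  qed
  also have "\<dots> \<le> (\<Sum>i=0..<r. real r / (real n - real r))"
  proof (rule sum_mono)
    fix i assume "i \<in> {0..<r}"
    then have i: "i < r" "i < n" "r < n" using assms by auto
    have "(real j - real i) / (real n - real i) - real j / real n =
        - (real i / (real n - real i)) * ((real n - real j) / real n)"
      using i by (simp add: field_simps)
    then have "norm ((real j - real i) / (real n - real i) - real j / real n) =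
        (real i / (real n - real i)) * ((real n - real j) / real n)"
      using i assms by (simp add: abs_mult)
    also have "\<dots> \<le> (real r / (real n - real r)) * 1"
      using i assms by (intro mult_mono frac_le) (auto simp: divide_le_eq)
    finally show "norm ((real j - real i) / (real n - real i) - real j / real n) \<le> real r / (real n - real r)"
      by simp
  qed
  finally show ?thesis by simp
qed

section \<open>The Hausdorff moment problem\<close>

text \<open>The moment functional applied to a Bernstein basis polynomial of degree \<open>n\<close>
  on [0, C]. Before the division by \<open>C ^ n\<close> these polynomials sum to (X + (C -
  X))^n.\<close>

definition bernstein_weight :: "real \<Rightarrow> (nat \<Rightarrow> real) \<Rightarrow> nat \<Rightarrow> nat \<Rightarrow> real" where
  "bernstein_weight C m n j = real (n choose j) * mfun m ([:0, 1:] ^ j * [:C, -1:] ^ (n - j)) / C ^ n"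

lemma bernstein_weight:
  assumes m: "moments_on C m" and C: "C > 0" and m0: "m 0 = 1"
  shows "bernstein_weight C m n j \<ge> 0" (is "?w n j \<ge> 0")
    and "r \<le> n \<Longrightarrow> (\<Sum>j\<le>n. real (j choose r) * bernstein_weight C m n j) = real (n choose r) * m r / C ^ r"
    and "(\<Sum>j\<le>n. bernstein_weight C m n j) = 1"
proof -
  show "?w n j \<ge> 0"
    unfolding bernstein_weight_def using moments_on_basis_nonneg[OF m C] C by simp
  show *: "(\<Sum>j\<le>n. real (j choose r) * ?w n j) = real (n choose r) * m r / C ^ r" if "r \<le> n" for r
  proof -
    \<comment> \<open>X and C - X add up to a constant, so the binomial identity collapses to a
      multiple of X^r and the single moment \<open>m r\<close> survives.\<close>
    have "[:0, 1:] + [:C, -1:] = [:C:]" by simp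
    have "(\<Sum>j\<le>n. real (j choose r) * ?w n j) =
      mfun m (\<Sum>j\<le>n. of_nat ((j choose r) * (n choose j)) * ([:0, 1:] ^ j * [:C, -1:] ^ (n - j))) / C ^ n"
      by (simp add: bernstein_weight_def mfun_sum sum_divide_distrib of_nat_poly mfun_smult mult.assoc
          flip: of_nat_mult) (simp add: mult.assoc)
    also have "\<dots> = mfun m (of_nat (n choose r) * [:0, 1:] ^ r * [:C:] ^ (n - r)) / C ^ n"
      by (simp only: binomial_moment_identity[OF that] \<open>[:0, 1:] + [:C, -1:] = [:C:]\<close>)
    also have "of_nat (n choose r) * [:0, 1:] ^ r * [:C:] ^ (n - r) =
        monom (real (n choose r) * C ^ (n - r)) r"
      by (simp add: of_nat_poly monom_altdef poly_const_pow mult.commute)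
    finally show ?thesis
      using C that by (simp add: mfun_monom power_diff)
  qed
  show "(\<Sum>j\<le>n. ?w n j) = 1"
    using *[of 0] m0 by simp
qed

text \<open>Weak convergence tests only bounded continuous functions. Clamping makes the power
  bounded and changes nothing on [0, C], where all the measures live.\<close>

lemma isCont_clamp_power: "isCont (\<lambda>x::real. (max 0 (min C x)) ^ r) x"
  by (intro continuous_intros)

text \<open>The measure is a weak limit of the Bernstein measures, which put mass
  \<open>bernstein_weight C m n j\<close> at \<open>C j / n\<close>.\<close>
theorem moments_on_imp_measure:
  assumes m: "moments_on C m" and C: "C > 0" and m0: "m 0 = 1"
  obtains M where "real_distribution M" "AE s in M. s \<in> {0..C}"
    "\<And>r. (\<integral>s. s ^ r \<partial>M) = m r"
proof -
  define w where "w = bernstein_weight C m"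
  note w = bernstein_weight[OF m C m0, folded w_def]
  define P where "P n = embed_pmf (\<lambda>j. if j \<le> n then w n j else 0)" for n
  have pmf_P: "pmf (P n) j = (if j \<le> n then w n j else 0)" for n j
    unfolding P_def
  proof (rule pmf_embed_pmf)
    have "(\<integral>\<^sup>+ j. ennreal (if j \<le> n then w n j else 0) \<partial>count_space UNIV) =
      (\<Sum>j\<le>n. ennreal (w n j))"
      by (subst nn_integral_count_space'[of "{..n}"]) (auto intro!: sum.cong split: if_splits)
    also have "\<dots> = ennreal (\<Sum>j\<le>n. w n j)"
      by (rule sum_ennreal) (rule w(1))
    finally show "(\<integral>\<^sup>+ j. ennreal (if j \<le> n then w n j else 0) \<partial>count_space UNIV) = 1"
      by (simp only: w(3) ennreal_1)
  qed (simp add: w)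
  define D where "D n = distr (measure_pmf (P n)) borel (\<lambda>j. C * real j / real n)" for n
  have rd: "real_distribution (D n)" for n
    unfolding D_def by (rule prob_space.real_distribution_distr[OF prob_space_measure_pmf]) simp
  have D_int: "(\<integral>s. f s \<partial>D n) = (\<Sum>j\<le>n. f (C * real j / real n) * w n j)"
    if "f \<in> borel_measurable borel" for n and f :: "real \<Rightarrow> real"
  proof -
    have "(\<integral>s. f s \<partial>D n) = (\<integral>j. f (C * real j / real n) \<partial>measure_pmf (P n))"
      unfolding D_def using that by (subst integral_distr) auto
    also have "\<dots> = (\<Sum>j\<le>n. f (C * real j / real n) * pmf (P n) j)"
      by (rule integral_measure_pmf_real) (auto simp: set_pmf_eq pmf_P split: if_splits)
    finally show ?thesis by (simp add: pmf_P)
  qed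
  have frac: "real j / real n \<in> {0..1}" if "j \<le> n" for j n :: nat
    using that by (cases "n = 0") (auto simp: divide_le_eq_1)
  \<comment> \<open>\<open>tight\<close> is phrased with half-open intervals, so the left end must
    lie strictly below a possible atom at 0.\<close>
  have D_supp: "measure (D n) {-1<..C} = 1" for n
  proof -
    have "measure (D n) {-1<..C} = (\<integral>s. indicator {-1<..C} s \<partial>D n)"
      using real_distribution.events_eq_borel[OF rd] by (simp add: real_distribution.space_eq_univ[OF rd])
    also have "\<dots> = (\<Sum>j\<le>n. indicator {-1<..C} (C * real j / real n) * w n j)"
      by (rule D_int) simp
    also have "\<dots> = (\<Sum>j\<le>n. w n j)"
    proof (rule sum.cong)
      fix j assume "j \<in> {..n}"
      then have "real j / real n \<in> {0..1}" by (intro frac) auto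
      then have "C * (real j / real n) \<in> {-1<..C}"
        using C mult_left_le[of "real j / real n" C] by (auto intro: less_le_trans[of _ 0])
      then show "indicator {-1<..C} (C * real j / real n) * w n j = w n j" by simp
    qed simp
    finally show ?thesis by (simp add: w)
  qed
  have "tight D"
    unfolding tight_def
  proof safe
    fix e :: real assume "e > 0"
    then show "\<exists>a b. a < b \<and> (\<forall>n. measure (D n) {a<..b} > 1 - e)"
      using C D_supp by (intro exI[of _ "-1"] exI[of _ C]) auto
  qed (rule rd)
  from tight_imp_convergent_subsubsequence[OF this strict_mono_id]
  obtain s M where s: "strict_mono s" and M: "real_distribution M" and conv: "weak_conv_m (D \<circ> s) M"
    by auto
  have lim: "(\<lambda>n. integral\<^sup>L (D (s n)) f) \<longlonglongrightarrow> integral\<^sup>L M f"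
    if "\<And>x. isCont f x" "\<And>x. norm (f x) \<le> B" for f :: "real \<Rightarrow> real" and B
    using weak_conv_imp_integral_bdd_continuous_conv[OF _ M conv that] rd by (simp add: o_def)
  interpret M: real_distribution M by fact
  \<comment> \<open>\<open>h\<close> is bounded, continuous and zero exactly on [0, C]. Every
    \<open>D n\<close> integrates it to 0, hence so does the weak limit, which confines
    \<open>M\<close> to [0, C].\<close>
  define g where "g x = \<bar>x - max 0 (min C x)\<bar>" for x
  define h where "h x = min 1 (g x)" for x
  have h_cont: "isCont h x" for x
    unfolding h_def g_def by (intro continuous_intros)
  have [measurable]: "h \<in> borel_measurable borel"
    unfolding h_def g_def by measurable
  have clamp: "max 0 (min C (C * real j / real n)) = C * real j / real n" if "j \<le> n" for j n
  proof -
    have "real j / real n \<in> {0..1}" using that by (rule frac)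
    then have "C * (real j / real n) \<in> {0..C}"
      using C mult_left_le[of "real j / real n" C] by auto
    then show ?thesis by simp
  qed
  have "integral\<^sup>L (D n) h = 0" for n
    by (subst D_int) (auto simp: clamp h_def g_def intro!: sum.neutral)
  with lim[of h 1] h_cont have "integral\<^sup>L M h = 0"
    by (auto simp: h_def g_def LIMSEQ_const_iff)
  moreover have "integrable M h"
    by (rule M.integrable_const_bound[of _ 1]) (auto simp: h_def g_def)
  moreover have "AE x in M. 0 \<le> h x" by (auto simp: h_def g_def)
  ultimately have "AE x in M. h x = 0"
    by (simp add: integral_nonneg_eq_0_iff_AE)
  then have supp: "AE x in M. x \<in> {0..C}"
    by (rule AE_mp) (use C in \<open>auto simp: h_def g_def min_def max_def split: if_splits\<close>)
  have "(\<integral>x. x ^ r \<partial>M) = m r" for r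
  proof -
    define f where "f x = (max 0 (min C x)) ^ r" for x
    have f_cont: "isCont f x" for x
      unfolding f_def by (rule isCont_clamp_power)
    have f_bd: "norm (f x) \<le> C ^ r" for x
      unfolding f_def using C by (auto simp: power_abs intro!: power_mono)
    have [measurable]: "f \<in> borel_measurable borel"
      unfolding f_def by measurable
    have "(\<integral>x. x ^ r \<partial>M) = (\<integral>x. f x \<partial>M)"
      by (rule integral_cong_AE) (use supp in \<open>auto simp: f_def elim!: AE_mp\<close>)
    \<comment> \<open>The moments converge along the whole sequence \<open>D\<close>; passing to the
      weakly convergent subsequence \<open>s\<close> comes last.\<close>
    moreover have "(\<lambda>n. integral\<^sup>L (D (s n)) f) \<longlonglongrightarrow> m r"
    proof -
      define \<epsilon> where "\<epsilon> n = real r * (real r / (real n - real r))" for n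
      have "\<epsilon> \<longlonglongrightarrow> 0"
        unfolding \<epsilon>_def by real_asymp
      then have "(\<lambda>n. C ^ r * \<epsilon> n) \<longlonglongrightarrow> 0"
        by (rule tendsto_mult_right_zero)
      moreover have "\<forall>\<^sub>F n in sequentially. norm (integral\<^sup>L (D n) f - m r) \<le> C ^ r * \<epsilon> n"
        using eventually_gt_at_top[of "2 * r"]
      proof eventually_elim
        case (elim n)
        have "integral\<^sup>L (D n) f = C ^ r * (\<Sum>j\<le>n. (real j / real n) ^ r * w n j)"
          by (subst D_int)
            (auto simp: f_def clamp sum_distrib_left power_mult_distrib power_divide intro!: sum.cong)
        moreover have "m r = C ^ r * (\<Sum>j\<le>n. real (j choose r) / real (n choose r) * w n j)"
          using w(2)[of r n] elim C by (simp add: field_simps flip: sum_divide_distrib)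
        ultimately have "integral\<^sup>L (D n) f - m r =
          C ^ r * (\<Sum>j\<le>n. ((real j / real n) ^ r - real (j choose r) / real (n choose r)) * w n j)"
          by (simp add: algebra_simps sum_subtractf)
        also have "norm \<dots> \<le> C ^ r * (\<Sum>j\<le>n. \<epsilon> n * w n j)"
          unfolding norm_mult using C
        proof (intro mult_mono order_trans[OF norm_sum] sum_mono)
          fix j assume "j \<in> {..n}"
          then have "\<bar>(real j / real n) ^ r - real (j choose r) / real (n choose r)\<bar> \<le> \<epsilon> n"
            using choose_quotient_approx[OF elim, of j] by (simp add: abs_minus_commute \<epsilon>_def)
          then show "norm (((real j / real n) ^ r - real (j choose r) / real (n choose r)) * w n j) \<le> \<epsilon> n * w n j"
            unfolding real_norm_def abs_mult abs_of_nonneg[OF w(1)] by (rule mult_right_mono) (rule w(1))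
        qed (auto intro!: sum_nonneg)
        finally show ?case
          by (simp add: w flip: sum_distrib_left)
      qed
      ultimately have "(\<lambda>n. integral\<^sup>L (D n) f - m r) \<longlonglongrightarrow> 0"
        by (rule Lim_null_comparison[rotated])
      then have "(\<lambda>n. integral\<^sup>L (D n) f) \<longlonglongrightarrow> m r"
        by (simp add: LIM_zero_iff)
      then show ?thesis
        using s by (rule LIMSEQ_subseq_LIMSEQ[unfolded o_def])
    qed
    ultimately show ?thesis
      using lim[OF f_cont f_bd] LIMSEQ_unique by auto
  qed
  with M supp show ?thesis by (rule that)
qed

section \<open>Distribution functions as limits of polynomial integrals; uniqueness; atoms\<close>

lemma indicator_atMost_poly_approx:
  obtains p :: "nat \<Rightarrow> real poly" where
    "\<And>j s. s \<in> {-R..R} \<Longrightarrow> \<bar>poly (p j) s\<bar> \<le> 2"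
    "\<And>s. s \<in> {-R..R} \<Longrightarrow> (\<lambda>j. poly (p j) s) \<longlonglongrightarrow> indicator {..E} s"
proof -
  \<comment> \<open>A ramp falling from 1 at \<open>E\<close> to 0 at E + 1/(j + 1). It descends to
    the right of \<open>E\<close>, so that the limit at \<open>E\<close> itself is 1. With |g| <= 1
    and a Weierstrass error of at most 1, the polynomials are dominated by 2.\<close>
  define g where "g j s = max 0 (min 1 (1 - real (Suc j) * (s - E)))" for j and s :: real
  have "\<exists>p. \<forall>s\<in>{-R..R}. \<bar>g j s - poly p s\<bar> < 1 / real (Suc j)" for j
  proof -
    have "continuous_on {-R..R} (g j)"
      unfolding g_def by (intro continuous_intros)
    then obtain q where q: "real_polynomial_function q" "\<And>x. x \<in> {-R..R} \<Longrightarrow> \<bar>g j x - q x\<bar> < 1 / real (Suc j)"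
      by (rule Stone_Weierstrass_real_polynomial_function[OF compact_Icc, of _ _ _ "1 / real (Suc j)"]) auto
    from q(1) obtain a n where "q = (\<lambda>x. \<Sum>i\<le>n. a i * x ^ i)"
      by (auto simp: real_polynomial_function_iff_sum)
    then have "q x = poly (\<Sum>i\<le>n. monom (a i) i) x" for x
      by (simp add: poly_sum poly_monom)
    with q(2) show ?thesis by metis
  qed
  then obtain p where p: "\<And>j s. s \<in> {-R..R} \<Longrightarrow> \<bar>g j s - poly (p j) s\<bar> < 1 / real (Suc j)"
    by metis
  show ?thesis
  proof (rule that[of p])
    fix j s assume s: "s \<in> {-R..R}"
    have "\<bar>g j s\<bar> \<le> 1" "1 / real (Suc j) \<le> 1" by (auto simp: g_def)
    then show "\<bar>poly (p j) s\<bar> \<le> 2" using p[OF s, of j] by linarith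
  next
    fix s assume s: "s \<in> {-R..R}"
    have "(\<lambda>j. g j s) \<longlonglongrightarrow> indicator {..E} s"
    proof (cases "s \<le> E")
      case True
      then have "real (Suc j) * (s - E) \<le> 0" for j by (simp add: mult_nonneg_nonpos)
      then have "g j s = 1" for j unfolding g_def by (smt (verit))
      then show ?thesis using True by simp
    next
      case False
      have "\<forall>\<^sub>F j in sequentially. real (Suc j) * (s - E) \<ge> 1"
        using False by real_asymp
      then have "\<forall>\<^sub>F j in sequentially. g j s = 0"
        by eventually_elim (auto simp: g_def)
      then show ?thesis using False by (simp add: tendsto_eventually)
    qed
    moreover have "(\<lambda>j. poly (p j) s - g j s) \<longlonglongrightarrow> 0"
    proof (rule Lim_null_comparison)
      show "\<forall>\<^sub>F j in sequentially. norm (poly (p j) s - g j s) \<le> 1 / real (Suc j)"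
        using p[OF s] by (auto simp: abs_minus_commute intro!: always_eventually less_imp_le)
      show "(\<lambda>j. 1 / real (Suc j)) \<longlonglongrightarrow> 0" by real_asymp
    qed
    ultimately have "(\<lambda>j. g j s + (poly (p j) s - g j s)) \<longlonglongrightarrow> indicator {..E} s + 0"
      by (rule tendsto_add)
    then show "(\<lambda>j. poly (p j) s) \<longlonglongrightarrow> indicator {..E} s" by simp
  qed
qed

lemma (in real_distribution) integral_poly_eq_mfun:
  assumes supp: "AE s in M. s \<in> {-R..R}" and mom: "\<And>r. (\<integral>s. s ^ r \<partial>M) = m r"
  shows "integrable M (poly p)" and "(\<integral>s. poly p s \<partial>M) = mfun m p"
proof -
  have int: "integrable M (\<lambda>s. s ^ r)" for r
    by (rule integrable_const_bound[of _ "R ^ r"])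
      (use supp in \<open>auto simp: power_abs intro!: power_mono elim!: AE_mp\<close>)
  show "integrable M (poly p)"
    unfolding poly_altdef using int by auto
  show "(\<integral>s. poly p s \<partial>M) = mfun m p"
    unfolding poly_altdef mfun_def using int by (simp add: mom)
qed

text \<open>The polynomials enter as hypotheses because one and the same sequence must serve two
  measures in the uniqueness proof and all configurations in the measurability proof.\<close>

lemma (in real_distribution) measure_atMost_limit:
  assumes supp: "AE s in M. s \<in> {-R..R}" and mom: "\<And>r. (\<integral>s. s ^ r \<partial>M) = m r"
    and p: "\<And>j s. s \<in> {-R..R} \<Longrightarrow> \<bar>poly (p j) s\<bar> \<le> 2"
      "\<And>s. s \<in> {-R..R} \<Longrightarrow> (\<lambda>j. poly (p j) s) \<longlonglongrightarrow> indicator {..E} s"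
  shows "(\<lambda>j. mfun m (p j)) \<longlonglongrightarrow> measure M {..E}"
proof -
  have "(\<lambda>j. \<integral>s. poly (p j) s \<partial>M) \<longlonglongrightarrow> (\<integral>s. indicator {..E} s \<partial>M)"
  proof (rule integral_dominated_convergence[where w = "\<lambda>_. 2"])
    show "AE x in M. (\<lambda>j. poly (p j) x) \<longlonglongrightarrow> indicator {..E} x"
      using supp p(2) by (auto elim!: AE_mp)
    show "AE x in M. norm (poly (p j) x) \<le> 2" for j
      using supp p(1) by (auto elim!: AE_mp)
    show "poly (p j) \<in> borel_measurable M" for j
      by (intro measurable_finite_borel borel_measurable_continuous_onI) (auto intro: continuous_intros)
  qed auto
  then show ?thesis
    by (simp add: integral_poly_eq_mfun[OF supp mom])
qed

lemma moment_measure_unique: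
  assumes "real_distribution M" "real_distribution M'"
    and "AE s in M. s \<in> {-R..R}" "AE s in M'. s \<in> {-R..R}"
    and "\<And>r. (\<integral>s. s ^ r \<partial>M) = m r" "\<And>r. (\<integral>s. s ^ r \<partial>M') = m r"
  shows "M = M'"
proof (rule cdf_unique)
  show "cdf M = cdf M'"
  proof
    fix E
    obtain p where p: "\<And>j s. s \<in> {-R..R} \<Longrightarrow> \<bar>poly (p j) s\<bar> \<le> 2"
      "\<And>s. s \<in> {-R..R} \<Longrightarrow> (\<lambda>j. poly (p j) s) \<longlonglongrightarrow> indicator {..E} s"
      using indicator_atMost_poly_approx[of R E] by blast
    show "cdf M E = cdf M' E"
      unfolding cdf_def
      using real_distribution.measure_atMost_limit[OF assms(1,3,5) p]
        real_distribution.measure_atMost_limit[OF assms(2,4,6) p] LIMSEQ_unique by blast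
  qed
qed fact+

text \<open>On \<open>[0, C]\<close> the squares of \<open>(1 - ((s - lam) / C)\<^sup>2) ^ n\<close> decrease to the indicator of \<open>lam\<close>.\<close>
lemma (in real_distribution) measure_atom_ge:
  assumes supp: "AE s in M. s \<in> {0..C}" and mom: "\<And>r. (\<integral>s. s ^ r \<partial>M) = m r"
    and C: "C > 0" and lam: "lam \<in> {0..C}" and a: "\<And>q. mfun m (q * q) \<ge> a * (poly q lam)\<^sup>2"
  shows "measure M {lam} \<ge> a"
proof -
  define q where "q n = ([:1, 0, -1 / C\<^sup>2:] \<circ>\<^sub>p [:-lam, 1:]) ^ n" for n
  have poly_q: "poly (q n) s = (1 - ((s - lam) / C)\<^sup>2) ^ n" for n s
    using C by (simp add: q_def poly_pcompose field_simps power2_eq_square)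
  have supp': "AE s in M. s \<in> {-C..C}"
    using supp by (rule AE_mp) (use C in auto)
  have bnd: "((s - lam) / C)\<^sup>2 \<le> 1" if "s \<in> {0..C}" for s
  proof -
    have "\<bar>s - lam\<bar> \<le> \<bar>C\<bar>" using that lam by auto
    then have "(s - lam)\<^sup>2 \<le> C\<^sup>2" by (simp only: abs_le_square_iff)
    then show ?thesis using C by (simp add: power_divide)
  qed
  have "(\<lambda>n. \<integral>s. poly (q n * q n) s \<partial>M) \<longlonglongrightarrow> (\<integral>s. indicator {lam} s \<partial>M)"
  proof (rule integral_dominated_convergence[where w = "\<lambda>_. 1"])
    show "AE s in M. (\<lambda>n. poly (q n * q n) s) \<longlonglongrightarrow> indicator {lam} s"
      using supp
    proof (rule AE_mp, intro AE_I2 impI)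
      fix s assume s: "s \<in> {0..C}"
      show "(\<lambda>n. poly (q n * q n) s) \<longlonglongrightarrow> indicator {lam} s"
      proof (cases "s = lam")
        case False
        then have "((s - lam) / C)\<^sup>2 > 0" using C by auto
        with bnd[OF s] have "(\<lambda>n. (1 - ((s - lam) / C)\<^sup>2) ^ n) \<longlonglongrightarrow> 0"
          by (intro LIMSEQ_power_zero) auto
        from tendsto_mult[OF this this] False show ?thesis by (simp add: poly_q)
      qed (simp add: poly_q)
    qed
    show "AE s in M. norm (poly (q n * q n) s) \<le> 1" for n
      using supp
    proof (rule AE_mp, intro AE_I2 impI)
      fix s assume s: "s \<in> {0..C}"
      then show "norm (poly (q n * q n) s) \<le> 1"
        using bnd[OF s] by (auto simp: poly_q abs_mult power_abs intro!: mult_le_one power_le_one)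
    qed
    show "poly (q n * q n) \<in> borel_measurable M" for n
      by (intro measurable_finite_borel borel_measurable_continuous_onI)
        (auto simp del: poly_mult intro: continuous_intros)
  qed auto
  then have "(\<lambda>n. mfun m (q n * q n)) \<longlonglongrightarrow> measure M {lam}"
    by (simp add: integral_poly_eq_mfun[OF supp' mom] del: poly_mult)
  \<comment> \<open>Every \<open>q n\<close> has the value 1 at \<open>lam\<close>.\<close>
  moreover have "a \<le> mfun m (q n * q n)" for n
    using a[of "q n"] by (simp add: poly_q)
  ultimately show ?thesis
    by (intro LIMSEQ_le_const) auto
qed

section \<open>Spectral measures of graph Laplacians\<close>

lemma sum_indicator_singleton_mult:
  fixes f :: "'a \<Rightarrow> real"
  assumes "finite F" "x \<in> F"
  shows "(\<Sum>y\<in>F. indicator {x} y * f y) = f x"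
proof -
  have "(\<Sum>y\<in>F. indicator {x} y * f y) = (\<Sum>y\<in>F. if y = x then f y else 0)"
    by (intro sum.cong) (auto simp: indicator_def)
  then show ?thesis using assms by simp
qed

lemma sum_lincomb_inner:
  fixes a b :: "nat \<Rightarrow> real"
  shows "(\<Sum>y\<in>F. (\<Sum>i\<in>I. a i * f i y) * (\<Sum>j\<in>J. b j * g j y)) =
    (\<Sum>i\<in>I. \<Sum>j\<in>J. a i * b j * (\<Sum>y\<in>F. f i y * g j y))"
proof -
  have "(\<Sum>y\<in>F. (\<Sum>i\<in>I. a i * f i y) * (\<Sum>j\<in>J. b j * g j y)) =
    (\<Sum>y\<in>F. \<Sum>i\<in>I. \<Sum>j\<in>J. a i * b j * (f i y * g j y))"
    by (simp add: sum_product ac_simps)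
  also have "\<dots> = (\<Sum>i\<in>I. \<Sum>y\<in>F. \<Sum>j\<in>J. a i * b j * (f i y * g j y))"
    by (rule sum.swap)
  also have "\<dots> = (\<Sum>i\<in>I. \<Sum>j\<in>J. \<Sum>y\<in>F. a i * b j * (f i y * g j y))"
    by (rule sum.cong[OF refl], rule sum.swap)
  finally show ?thesis by (simp add: sum_distrib_left)
qed

text \<open>The three Laplacians share the off-diagonal part and differ only in this diagonal entry
  at a vertex of degree \<open>d\<close>, which allows uniform proofs.\<close>

definition lap_diag :: "lap_type \<Rightarrow> nat \<Rightarrow> real \<Rightarrow> real" where
  "lap_diag t k d = (case t of LapA \<Rightarrow> real k | LapD \<Rightarrow> 2 * real k - d | LapN \<Rightarrow> d)"

locale bounded_degree_graph =
  fixes W :: "'a set" and adj :: "'a \<Rightarrow> 'a \<Rightarrow> bool" and k :: nat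
  assumes adj_sym: "adj x y \<Longrightarrow> adj y x"
    and adj_in: "adj x y \<Longrightarrow> x \<in> W"
    and finite_nbrs: "finite {y. adj x y}"
    and card_nbrs: "card {y. adj x y} \<le> k"
begin

abbreviation deg :: "'a \<Rightarrow> real" where "deg x \<equiv> real (card {y. adj x y})"

lemma nbrs_W: "{y \<in> W. adj x y} = {y. adj x y}"
  using adj_in adj_sym by blast

lemma lapop_altdef:
  "lapop t k W adj \<phi> x = (if x \<in> W then lap_diag t k (deg x) * \<phi> x - (\<Sum>y | adj x y. \<phi> y) else 0)"
  by (cases t) (simp_all add: lapop_def lap_diag_def gdeg_def adjop_def nbrs_W)

text \<open>The two diagonal dominance facts behind 0 <= Delta <= 2k, common to all three
  types.\<close>

lemma lap_diag_bounds:
  "deg x \<le> lap_diag t k (deg x)" "lap_diag t k (deg x) + deg x \<le> 2 * real k"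
  using card_nbrs[of x] by (cases t; simp add: lap_diag_def)+

lemma sum_nbrs_restrict:
  assumes "finite F" "\<And>y. y \<notin> F \<Longrightarrow> \<phi> y = (0::real)"
  shows "(\<Sum>y | adj x y. \<phi> y) = (\<Sum>y\<in>F. if adj x y then \<phi> y else 0)"
proof -
  have "(\<Sum>y | adj x y. \<phi> y) = (\<Sum>y\<in>{y\<in>F. adj x y}. \<phi> y)"
    by (rule sum.mono_neutral_right) (use finite_nbrs assms in auto)
  also have "\<dots> = (\<Sum>y\<in>F. if adj x y then \<phi> y else 0)"
    using assms(1) by (simp add: sum.inter_filter)
  finally show ?thesis .
qed

lemma lapop_linear:
  "lapop t k W adj (\<lambda>x. \<Sum>i\<in>I. c i * \<phi> i x) x = (\<Sum>i\<in>I. c i * lapop t k W adj (\<phi> i) x)"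
proof (cases "x \<in> W")
  case True
  have "(\<Sum>y | adj x y. \<Sum>i\<in>I. c i * \<phi> i y) = (\<Sum>i\<in>I. c i * (\<Sum>y | adj x y. \<phi> i y))"
    by (subst sum.swap) (simp add: sum_distrib_left)
  with True show ?thesis
    by (simp add: lapop_altdef sum_subtractf sum_distrib_left algebra_simps)
qed (simp add: lapop_altdef)

lemma lapop_inner_sym:
  assumes F: "finite F" "F \<subseteq> W" and \<phi>: "\<And>y. y \<notin> F \<Longrightarrow> \<phi> y = 0" and \<psi>: "\<And>y. y \<notin> F \<Longrightarrow> \<psi> y = 0"
  shows "(\<Sum>x\<in>F. lapop t k W adj \<phi> x * \<psi> x) = (\<Sum>x\<in>F. \<phi> x * lapop t k W adj \<psi> x)"
proof -
  have 1: "(\<Sum>x\<in>F. lapop t k W adj \<phi> x * \<psi> x) =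
    (\<Sum>x\<in>F. lap_diag t k (deg x) * \<phi> x * \<psi> x) - (\<Sum>x\<in>F. \<Sum>y\<in>F. if adj x y then \<phi> y * \<psi> x else 0)"
    if "\<And>y. y \<notin> F \<Longrightarrow> \<phi> y = 0" for \<phi> \<psi>
  proof -
    have "lapop t k W adj \<phi> x * \<psi> x = lap_diag t k (deg x) * \<phi> x * \<psi> x -
       (\<Sum>y\<in>F. if adj x y then \<phi> y * \<psi> x else 0)" if "x \<in> F" for x
      using that F \<open>\<And>y. y \<notin> F \<Longrightarrow> \<phi> y = 0\<close>
      by (auto simp: lapop_altdef sum_nbrs_restrict[of F] algebra_simps sum_distrib_left intro!: sum.cong)
    then show ?thesis by (simp add: sum_subtractf)
  qed
  have "(\<Sum>x\<in>F. \<Sum>y\<in>F. if adj x y then \<phi> y * \<psi> x else 0) = (\<Sum>x\<in>F. \<Sum>y\<in>F. if adj x y then \<psi> y * \<phi> x else 0)"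
    by (subst sum.swap) (auto intro!: sum.cong dest: adj_sym simp: mult.commute)
  then show ?thesis
    using 1[of \<phi> \<psi>, OF \<phi>] 1[of \<psi> \<phi>, OF \<psi>] by (simp add: ac_simps)
qed

text \<open>By 2|ab| <= a^2 + b^2 the adjacency part of the form is at most the sum of degree times
  square, and \<open>lap_diag_bounds\<close> then gives both sides. \<open>F\<close> is a finite set
  carrying the vector, while \<open>W\<close> may be infinite.\<close>

lemma lapop_form_bounds:
  assumes F: "finite F" "F \<subseteq> W" and \<psi>: "\<And>y. y \<notin> F \<Longrightarrow> \<psi> y = 0"
  shows "0 \<le> (\<Sum>x\<in>F. lapop t k W adj \<psi> x * \<psi> x)"
    and "(\<Sum>x\<in>F. lapop t k W adj \<psi> x * \<psi> x) \<le> 2 * real k * (\<Sum>x\<in>F. (\<psi> x)\<^sup>2)"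
proof -
  define I where "I = (\<Sum>x\<in>F. \<Sum>y\<in>F. if adj x y then \<psi> y * \<psi> x else 0)"
  define J where "J = (\<Sum>x\<in>F. deg x * (\<psi> x)\<^sup>2)"
  have "lapop t k W adj \<psi> x * \<psi> x = lap_diag t k (deg x) * (\<psi> x)\<^sup>2 -
       (\<Sum>y\<in>F. if adj x y then \<psi> y * \<psi> x else 0)" if "x \<in> F" for x
    using that F \<psi>
    by (auto simp: lapop_altdef sum_nbrs_restrict[of F] algebra_simps sum_distrib_left power2_eq_square
        intro!: sum.cong)
  then have eq: "(\<Sum>x\<in>F. lapop t k W adj \<psi> x * \<psi> x) = (\<Sum>x\<in>F. lap_diag t k (deg x) * (\<psi> x)\<^sup>2) - I"
    by (simp add: sum_subtractf I_def)
  \<comment> \<open>Only an inequality, since neighbours outside \<open>F\<close> are lost.\<close>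
  have degF: "(\<Sum>y\<in>F. if adj x y then (\<psi> x)\<^sup>2 else 0) \<le> deg x * (\<psi> x)\<^sup>2" for x
  proof -
    have "(\<Sum>y\<in>F. if adj x y then (\<psi> x)\<^sup>2 else 0) = real (card {y\<in>F. adj x y}) * (\<psi> x)\<^sup>2"
      using F(1) by (simp flip: sum.inter_filter)
    also have "\<dots> \<le> deg x * (\<psi> x)\<^sup>2"
      using finite_nbrs by (intro mult_right_mono of_nat_mono card_mono) auto
    finally show ?thesis .
  qed
  have "\<bar>I\<bar> \<le> (\<Sum>x\<in>F. \<Sum>y\<in>F. if adj x y then ((\<psi> y)\<^sup>2 + (\<psi> x)\<^sup>2) / 2 else 0)"
    unfolding I_def
  proof (intro order_trans[OF sum_abs] sum_mono)
    fix x y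
    have "2 * \<bar>\<psi> y * \<psi> x\<bar> \<le> (\<psi> y)\<^sup>2 + (\<psi> x)\<^sup>2"
      using sum_squares_bound[of "\<bar>\<psi> y\<bar>" "\<bar>\<psi> x\<bar>"] by (simp add: abs_mult)
    then show "\<bar>if adj x y then \<psi> y * \<psi> x else 0\<bar> \<le> (if adj x y then ((\<psi> y)\<^sup>2 + (\<psi> x)\<^sup>2) / 2 else 0)"
      by simp
  qed
  also have "\<dots> = (\<Sum>x\<in>F. \<Sum>y\<in>F. if adj x y then (\<psi> y)\<^sup>2 / 2 else 0) + (\<Sum>x\<in>F. \<Sum>y\<in>F. if adj x y then (\<psi> x)\<^sup>2 / 2 else 0)"
    unfolding sum.distrib[symmetric] by (intro sum.cong) (auto simp: field_simps)
  also have "(\<Sum>x\<in>F. \<Sum>y\<in>F. if adj x y then (\<psi> y)\<^sup>2 / 2 else 0) = (\<Sum>x\<in>F. \<Sum>y\<in>F. if adj x y then (\<psi> x)\<^sup>2 / 2 else 0)"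
    by (subst sum.swap) (auto intro!: sum.cong dest: adj_sym)
  also have "\<dots> + \<dots> = (\<Sum>x\<in>F. \<Sum>y\<in>F. if adj x y then (\<psi> x)\<^sup>2 else 0)"
    unfolding sum.distrib[symmetric] by (intro sum.cong) auto
  also have "\<dots> \<le> J"
    unfolding J_def by (intro sum_mono degF)
  finally have IJ: "\<bar>I\<bar> \<le> J" .
  have "J \<le> (\<Sum>x\<in>F. lap_diag t k (deg x) * (\<psi> x)\<^sup>2)"
    unfolding J_def by (intro sum_mono mult_right_mono lap_diag_bounds) auto
  then show "0 \<le> (\<Sum>x\<in>F. lapop t k W adj \<psi> x * \<psi> x)"
    using IJ eq by linarith
  have "(\<Sum>x\<in>F. lap_diag t k (deg x) * (\<psi> x)\<^sup>2) + J = (\<Sum>x\<in>F. (lap_diag t k (deg x) + deg x) * (\<psi> x)\<^sup>2)"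
    by (simp add: J_def sum.distrib distrib_right)
  also have "\<dots> \<le> (\<Sum>x\<in>F. 2 * real k * (\<psi> x)\<^sup>2)"
    by (intro sum_mono mult_right_mono lap_diag_bounds) auto
  finally show "(\<Sum>x\<in>F. lapop t k W adj \<psi> x * \<psi> x) \<le> 2 * real k * (\<Sum>x\<in>F. (\<psi> x)\<^sup>2)"
    using IJ eq by (simp add: sum_distrib_left)
qed

section \<open>Finite propagation and positivity of the moments\<close>

fun graph_ball :: "'a \<Rightarrow> nat \<Rightarrow> 'a set" where
  "graph_ball x 0 = {x}"
| "graph_ball x (Suc n) = graph_ball x n \<union> (\<Union>y\<in>graph_ball x n. {z. adj y z})"

lemma finite_graph_ball: "finite (graph_ball x n)"
  by (induction n) (auto simp: finite_nbrs)

lemma graph_ball_subset: "x \<in> W \<Longrightarrow> graph_ball x n \<subseteq> W"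
  by (induction n) (auto intro: adj_in[OF adj_sym])

lemma graph_ball_mono: "n \<le> n' \<Longrightarrow> graph_ball x n \<subseteq> graph_ball x n'"
  by (rule lift_Suc_mono_le[of "graph_ball x"]) auto

text \<open>Each application of the operator spreads the support by one edge. This turns inner
  products on l^2(W) into sums over finite sets.\<close>

lemma lapop_power_support:
  "y \<notin> graph_ball x n \<Longrightarrow> i \<le> n \<Longrightarrow> (lapop t k W adj ^^ i) (indicator {x}) y = 0"
proof (induction i arbitrary: n y)
  case 0
  then show ?case using graph_ball_mono[of 0 n x] by (auto simp: indicator_def)
next
  case (Suc i)
  obtain n' where n: "n = Suc n'" "i \<le> n'" using Suc.prems by (cases n) auto
  have *: "z \<notin> graph_ball x n'" if "z = y \<or> adj y z" for z
    using that Suc.prems(1) adj_sym n by auto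
  show ?case
    using Suc.IH[OF *] n by (auto simp: lapop_altdef)
qed

definition lap_moment :: "lap_type \<Rightarrow> 'a \<Rightarrow> nat \<Rightarrow> real" where
  "lap_moment t x i = (lapop t k W adj ^^ i) (indicator {x}) x"

text \<open>Symmetry moves the operator from the left vector to the right one, a factor at a time.
  \<open>F\<close> may exceed the ball so that the support of an eigenvector can be included
  later.\<close>

lemma lap_moment_inner:
  assumes "x \<in> W" "i + j \<le> n" "finite F" "graph_ball x n \<subseteq> F" "F \<subseteq> W"
  shows "(\<Sum>y\<in>F. (lapop t k W adj ^^ i) (indicator {x}) y * (lapop t k W adj ^^ j) (indicator {x}) y) =
    lap_moment t x (i + j)"
  using assms(2)
proof (induction i arbitrary: j)
  case 0
  have "x \<in> F" using assms(4) graph_ball_mono[of 0 n x] by auto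
  then show ?case
    using sum_indicator_singleton_mult[OF assms(3)] by (simp add: lap_moment_def del: sum_indicator_mult)
next
  case (Suc i)
  have supp: "(lapop t k W adj ^^ i) (indicator {x}) y = 0" "(lapop t k W adj ^^ j) (indicator {x}) y = 0"
    if "y \<notin> F" for y
  proof -
    have "y \<notin> graph_ball x n" using that assms(4) by auto
    then show "(lapop t k W adj ^^ i) (indicator {x}) y = 0" "(lapop t k W adj ^^ j) (indicator {x}) y = 0"
      by (rule lapop_power_support, use Suc.prems in simp)+
  qed
  have "(\<Sum>y\<in>F. (lapop t k W adj ^^ Suc i) (indicator {x}) y * (lapop t k W adj ^^ j) (indicator {x}) y) =
    (\<Sum>y\<in>F. (lapop t k W adj ^^ i) (indicator {x}) y * (lapop t k W adj ^^ Suc j) (indicator {x}) y)"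
    using lapop_inner_sym[OF assms(3,5) supp] by simp
  also have "\<dots> = lap_moment t x (i + Suc j)"
    using Suc.prems by (intro Suc.IH) auto
  finally show ?case by simp
qed

text \<open>The vector q(Delta) delta_x.\<close>

definition poly_vec :: "lap_type \<Rightarrow> 'a \<Rightarrow> real poly \<Rightarrow> 'a \<Rightarrow> real" where
  "poly_vec t x q y = (\<Sum>i\<le>degree q. coeff q i * (lapop t k W adj ^^ i) (indicator {x}) y)"

lemma poly_vec_support:
  assumes "y \<notin> graph_ball x n" "degree q \<le> n"
  shows "poly_vec t x q y = 0"
  unfolding poly_vec_def using assms by (intro sum.neutral) (auto simp: lapop_power_support)

lemma mfun_lap_moment_square:
  assumes "x \<in> W" "2 * degree q \<le> n" "finite F" "graph_ball x n \<subseteq> F" "F \<subseteq> W"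
  shows "mfun (lap_moment t x) (q * q) = (\<Sum>y\<in>F. (poly_vec t x q y)\<^sup>2)"
proof -
  have "(\<Sum>y\<in>F. (poly_vec t x q y)\<^sup>2) = (\<Sum>i\<le>degree q. \<Sum>j\<le>degree q. coeff q i * coeff q j *
      (\<Sum>y\<in>F. (lapop t k W adj ^^ i) (indicator {x}) y * (lapop t k W adj ^^ j) (indicator {x}) y))"
    unfolding power2_eq_square poly_vec_def by (rule sum_lincomb_inner)
  also have "\<dots> = (\<Sum>i\<le>degree q. \<Sum>j\<le>degree q. coeff q i * coeff q j * lap_moment t x (i + j))"
    using assms by (intro sum.cong refl arg_cong2[where f = "(*)"] lap_moment_inner[of _ _ _ n]) auto
  finally show ?thesis by (simp add: mfun_mult)
qed

lemma mfun_lap_moment_X_square: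
  assumes "x \<in> W" "Suc (2 * degree q) \<le> n" "finite F" "graph_ball x n \<subseteq> F" "F \<subseteq> W"
  shows "mfun (lap_moment t x) ([:0, 1:] * q * q) =
     (\<Sum>y\<in>F. lapop t k W adj (poly_vec t x q) y * poly_vec t x q y)"
proof -
  have "lapop t k W adj (poly_vec t x q) y =
      (\<Sum>i\<le>degree q. coeff q i * (lapop t k W adj ^^ Suc i) (indicator {x}) y)" for y
    unfolding poly_vec_def[abs_def] by (simp add: lapop_linear)
  then have "(\<Sum>y\<in>F. lapop t k W adj (poly_vec t x q) y * poly_vec t x q y) =
     (\<Sum>i\<le>degree q. \<Sum>j\<le>degree q. coeff q i * coeff q j *
      (\<Sum>y\<in>F. (lapop t k W adj ^^ Suc i) (indicator {x}) y * (lapop t k W adj ^^ j) (indicator {x}) y))"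
    by (simp only: poly_vec_def sum_lincomb_inner)
  also have "\<dots> = (\<Sum>i\<le>degree q. \<Sum>j\<le>degree q. coeff q i * coeff q j * lap_moment t x (Suc i + j))"
    using assms by (intro sum.cong refl arg_cong2[where f = "(*)"] lap_moment_inner[of _ _ _ n]) auto
  finally show ?thesis by (simp add: mfun_X_mult del: mult_pCons_left)
qed

text \<open>For v = q(Delta) delta_x the three conditions read ||v||^2 >= 0, <Delta v, v> >= 0 and
  <Delta v, v> <= 2k ||v||^2.\<close>

lemma moments_on_lap_moment:
  assumes "x \<in> W"
  shows "moments_on (2 * real k) (lap_moment t x)"
  unfolding moments_on_def
proof (intro allI conjI)
  fix q :: "real poly"
  \<comment> \<open>The factor X costs one more step of propagation than q * q.\<close>
  define F where "F = graph_ball x (Suc (2 * degree q))"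
  have F: "finite F" "F \<subseteq> W"
    unfolding F_def using finite_graph_ball graph_ball_subset assms by blast+
  have sq: "mfun (lap_moment t x) (q * q) = (\<Sum>y\<in>F. (poly_vec t x q y)\<^sup>2)"
    by (rule mfun_lap_moment_square[of _ _ "Suc (2 * degree q)"]) (use assms F in \<open>auto simp: F_def\<close>)
  have Xsq: "mfun (lap_moment t x) ([:0, 1:] * q * q) =
      (\<Sum>y\<in>F. lapop t k W adj (poly_vec t x q) y * poly_vec t x q y)"
    by (rule mfun_lap_moment_X_square[of _ _ "Suc (2 * degree q)"]) (use assms F in \<open>auto simp: F_def\<close>)
  have supp: "poly_vec t x q y = 0" if "y \<notin> F" for y
    using that unfolding F_def by (rule poly_vec_support) simp
  show "0 \<le> mfun (lap_moment t x) (q * q)"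
    unfolding sq by (intro sum_nonneg) auto
  show "0 \<le> mfun (lap_moment t x) ([:0, 1:] * q * q)"
    unfolding Xsq using F supp by (rule lapop_form_bounds)
  have "[:2 * real k, -1:] = smult (2 * real k) 1 + smult (-1) [:0, 1:]" by simp
  then have "[:2 * real k, -1:] * q * q = smult (2 * real k) (q * q) + smult (-1) ([:0, 1:] * q * q)"
    by (simp only: distrib_right mult_smult_left mult_1_left)
  then have "mfun (lap_moment t x) ([:2 * real k, -1:] * q * q) =
      2 * real k * mfun (lap_moment t x) (q * q) + (-1) * mfun (lap_moment t x) ([:0, 1:] * q * q)"
    by (simp only: mfun_add mfun_smult)
  then show "0 \<le> mfun (lap_moment t x) ([:2 * real k, -1:] * q * q)"
    unfolding sq Xsq using lapop_form_bounds(2)[where t = t and \<psi> = "poly_vec t x q", OF F supp] by linarith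
qed

text \<open>Resolves the definite description: existence by the moment problem, uniqueness among all
  compactly supported finite measures. Everything later rests on these three facts alone.\<close>

lemma spectral_measure:
  assumes "x \<in> W" "k > 0"
  shows "real_distribution (spectral_measure t k W adj x)"
    and "AE s in spectral_measure t k W adj x. s \<in> {0..2 * real k}"
    and "(\<integral>s. s ^ r \<partial>spectral_measure t k W adj x) = lap_moment t x r"
proof -
  have k: "2 * real k > 0" and m0: "lap_moment t x 0 = 1"
    using assms by (auto simp: lap_moment_def)
  obtain M where M: "real_distribution M" "AE s in M. s \<in> {0..2 * real k}"
    "\<And>r. (\<integral>s. s ^ r \<partial>M) = lap_moment t x r"
    using moments_on_imp_measure[OF moments_on_lap_moment[OF assms(1)] k m0] by metis
  interpret M: real_distribution M by fact
  have "spectral_measure t k W adj x = M"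
    unfolding spectral_measure_def
  proof (rule the_equality, intro conjI exI allI)
    have "AE s in M. s \<notin> - {-(2 * real k)..2 * real k}"
      using M(2) by (rule AE_mp) (use k in \<open>intro AE_I2, auto\<close>)
    then show "emeasure M (- {-(2 * real k)..2 * real k}) = 0"
      by (subst (asm) AE_iff_measurable[where N = "- {-(2 * real k)..2 * real k}"]) auto
    show "(\<integral>s. s ^ r \<partial>M) = (lapop t k W adj ^^ r) (indicator {x}) x" for r
      by (simp add: M(3) lap_moment_def)
  next
    fix \<mu> :: "real measure"
    assume "sets \<mu> = sets borel \<and> finite_measure \<mu> \<and> (\<exists>R. emeasure \<mu> (- {-R..R}) = 0) \<and>
      (\<forall>r. (\<integral>s. s ^ r \<partial>\<mu>) = (lapop t k W adj ^^ r) (indicator {x}) x)"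
    then obtain R where mu: "sets \<mu> = sets borel" "finite_measure \<mu>" "emeasure \<mu> (- {-R..R}) = 0"
      "\<And>r. (\<integral>s. s ^ r \<partial>\<mu>) = lap_moment t x r"
      unfolding lap_moment_def by blast
    interpret mu: finite_measure \<mu> by fact
    \<comment> \<open>A competitor is only known to be finite; its zeroth moment makes it a
      probability measure.\<close>
    have "measure \<mu> (space \<mu>) = 1"
      using mu(4)[of 0] m0 by simp
    then have "prob_space \<mu>"
      by (intro prob_spaceI) (simp add: mu.emeasure_eq_measure)
    with mu(1) have rd: "real_distribution \<mu>"
      by (simp add: real_distribution_def real_distribution_axioms_def)
    \<comment> \<open>A common interval for both measures, whatever bound the competitor came
      with.\<close>
    define R' where "R' = max R (2 * real k)"
    have sp: "space \<mu> = UNIV" using sets_eq_imp_space_eq[OF mu(1)] by simp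
    have "AE s in \<mu>. s \<in> {-R..R}"
      by (subst AE_iff_measurable[where N = "- {-R..R}"]) (auto simp: mu sp)
    then have "AE s in \<mu>. s \<in> {-R'..R'}"
      by (rule AE_mp) (auto simp: R'_def)
    moreover have "AE s in M. s \<in> {-R'..R'}"
      using M(2) by (rule AE_mp) (auto simp: R'_def)
    ultimately show "\<mu> = M"
      using moment_measure_unique[OF rd M(1) _ _ mu(4) M(3)] by blast
  qed (auto intro: M.finite_measure_axioms)
  with M show "real_distribution (spectral_measure t k W adj x)"
    "AE s in spectral_measure t k W adj x. s \<in> {0..2 * real k}"
    "(\<integral>s. s ^ r \<partial>spectral_measure t k W adj x) = lap_moment t x r"
    by auto
qed

lemma lapop_eigenvector_power_inner:
  assumes x: "x \<in> W" "i \<le> n" and F: "finite F" "graph_ball x n \<subseteq> F" "F \<subseteq> W"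
    and \<phi>: "\<And>y. y \<notin> F \<Longrightarrow> \<phi> y = 0" "\<And>y. lapop t k W adj \<phi> y = lam * \<phi> y"
  shows "(\<Sum>y\<in>F. (lapop t k W adj ^^ i) (indicator {x}) y * \<phi> y) = lam ^ i * \<phi> x"
  using x(2)
proof (induction i)
  case 0
  have "x \<in> F" using F(2) graph_ball_mono[of 0 n x] by auto
  then show ?case
    using sum_indicator_singleton_mult[OF F(1)] by (simp del: sum_indicator_mult)
next
  case (Suc i)
  have "(lapop t k W adj ^^ i) (indicator {x}) y = 0" if "y \<notin> F" for y
    using that F(2) Suc.prems lapop_power_support[of y x n i] by auto
  from lapop_inner_sym[OF F(1,3) this \<phi>(1)] Suc \<phi>(2) show ?case
    by (simp add: algebra_simps flip: sum_distrib_left)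
qed

text \<open>Pairing q(Delta) delta_x with the eigenvector gives q(lam) phi(x). Cauchy-Schwarz turns
  this into the lower bound on ||q(Delta) delta_x||^2 that \<open>measure_atom_ge\<close> asks for.
  It is only an inequality because \<open>lam\<close> may have further eigenvectors.\<close>

lemma spectral_measure_eigenvector:
  assumes x: "x \<in> W" and k: "k > 0" and K: "finite K" "K \<subseteq> W"
    and \<phi>: "\<And>y. y \<notin> K \<Longrightarrow> \<phi> y = 0" "\<And>y. lapop t k W adj \<phi> y = lam * \<phi> y" "\<phi> x \<noteq> 0"
  shows "measure (spectral_measure t k W adj x) {lam} \<ge> (\<phi> x)\<^sup>2 / (\<Sum>y\<in>K. (\<phi> y)\<^sup>2)"
proof -
  have "x \<in> K" using \<phi> by blast
  then have pos: "(\<Sum>y\<in>K. (\<phi> y)\<^sup>2) > 0"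
    using \<phi>(3) K(1) by (intro sum_pos2[of _ x]) auto
  have "(\<Sum>y\<in>K. lapop t k W adj \<phi> y * \<phi> y) = lam * (\<Sum>y\<in>K. (\<phi> y)\<^sup>2)"
    by (simp add: \<phi>(2) sum_distrib_left power2_eq_square mult.assoc)
  with lapop_form_bounds[where t = t and \<psi> = \<phi>, OF K \<phi>(1)] pos have lam: "lam \<in> {0..2 * real k}"
    by (auto simp: zero_le_mult_iff)
  show ?thesis
  proof (rule real_distribution.measure_atom_ge[OF spectral_measure[OF x k] _ lam])
    fix q :: "real poly"
    define F where "F = graph_ball x (2 * degree q) \<union> K"
    have F: "finite F" "graph_ball x (2 * degree q) \<subseteq> F" "F \<subseteq> W"
      unfolding F_def using finite_graph_ball graph_ball_subset x K by auto
    have supp: "\<phi> y = 0" if "y \<notin> F" for y using that \<phi>(1) by (auto simp: F_def)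
    have "(\<Sum>y\<in>F. poly_vec t x q y * \<phi> y) =
       (\<Sum>i\<le>degree q. coeff q i * (\<Sum>y\<in>F. (lapop t k W adj ^^ i) (indicator {x}) y * \<phi> y))"
      unfolding poly_vec_def sum_distrib_left sum_distrib_right by (subst sum.swap) (simp add: ac_simps)
    also have "\<dots> = (\<Sum>i\<le>degree q. coeff q i * (lam ^ i * \<phi> x))"
      using x F supp \<phi>(2)
      by (intro sum.cong refl arg_cong2[where f = "(*)"] lapop_eigenvector_power_inner[of _ _ "2 * degree q"]) auto
    also have "\<dots> = poly q lam * \<phi> x"
      by (simp add: poly_altdef sum_distrib_right mult.assoc)
    finally have "(poly q lam * \<phi> x)\<^sup>2 \<le> (\<Sum>y\<in>F. (poly_vec t x q y)\<^sup>2) * (\<Sum>y\<in>F. (\<phi> y)\<^sup>2)"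
      using Cauchy_Schwarz_ineq_sum[of "poly_vec t x q" \<phi> F] by simp
    moreover have "(\<Sum>y\<in>F. (\<phi> y)\<^sup>2) = (\<Sum>y\<in>K. (\<phi> y)\<^sup>2)"
      by (rule sum.mono_neutral_right) (use F \<phi>(1) in \<open>auto simp: F_def\<close>)
    moreover have "mfun (lap_moment t x) (q * q) = (\<Sum>y\<in>F. (poly_vec t x q y)\<^sup>2)"
      using x F by (intro mfun_lap_moment_square[of _ _ "2 * degree q"]) auto
    ultimately show "(\<phi> x)\<^sup>2 / (\<Sum>y\<in>K. (\<phi> y)\<^sup>2) * (poly q lam)\<^sup>2 \<le> mfun (lap_moment t x) (q * q)"
      using pos by (simp add: field_simps power_mult_distrib)
  qed (use k in auto)
qed

end

section \<open>Laplacians of random graphs\<close>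

text \<open>\<open>nbr\<close> is a finite set of potential neighbours independent of the
  configuration. Sums over random neighbourhoods thereby become fixed finite sums of measurable
  terms.\<close>

locale random_graph = prob_space M for M :: "'w measure" +
  fixes W :: "'w \<Rightarrow> 'a set" and adj :: "'w \<Rightarrow> 'a \<Rightarrow> 'a \<Rightarrow> bool" and k :: nat and nbr :: "'a \<Rightarrow> 'a set"
  assumes graph: "bounded_degree_graph (W \<omega>) (adj \<omega>) k"
    and k_pos: "k > 0"
    and finite_nbr: "finite (nbr x)"
    and adj_nbr: "adj \<omega> x y \<Longrightarrow> y \<in> nbr x"
    and W_measurable [measurable]: "Measurable.pred M (\<lambda>\<omega>. x \<in> W \<omega>)"
    and adj_measurable [measurable]: "Measurable.pred M (\<lambda>\<omega>. adj \<omega> x y)"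
begin

lemma lapop_measurable [measurable]:
  "(\<lambda>\<omega>. (lapop t k (W \<omega>) (adj \<omega>) ^^ i) \<phi> x) \<in> borel_measurable M"
proof (induction i arbitrary: x)
  case (Suc i)
  note [measurable] = Suc.IH
  define g where "g \<omega> = (lapop t k (W \<omega>) (adj \<omega>) ^^ i) \<phi>" for \<omega>
  have [measurable]: "(\<lambda>\<omega>. g \<omega> y) \<in> borel_measurable M" for y
    unfolding g_def by measurable
  have nbr: "{y. adj \<omega> x y} = {y \<in> nbr x. adj \<omega> x y}" for \<omega>
    using adj_nbr by auto
  define d where "d \<omega> = (\<Sum>y\<in>nbr x. if adj \<omega> x y then 1 else 0 :: real)" for \<omega>
  have "real (card {y \<in> nbr x. adj \<omega> x y}) = d \<omega>" for \<omega>
    unfolding d_def using finite_nbr by (simp flip: sum.inter_filter)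
  then have "(lapop t k (W \<omega>) (adj \<omega>) ^^ Suc i) \<phi> x = (if x \<in> W \<omega> then lap_diag t k (d \<omega>) * g \<omega> x
       - (\<Sum>y\<in>nbr x. if adj \<omega> x y then g \<omega> y else 0) else 0)" for \<omega>
    unfolding g_def using finite_nbr[of x]
    by (simp add: bounded_degree_graph.lapop_altdef[OF graph] nbr sum.inter_filter)
  moreover have "(\<lambda>\<omega>. lap_diag t k (d \<omega>)) \<in> borel_measurable M"
    unfolding lap_diag_def d_def by (cases t) (simp_all, measurable)
  ultimately show ?case by simp
qed simp

lemma spectral_distribution_measurable [measurable]:
  "(\<lambda>\<omega>. if x \<in> W \<omega> then measure (spectral_measure t k (W \<omega>) (adj \<omega>) x) {..E} else 0) \<in> borel_measurable M"
proof -
  \<comment> \<open>Chosen from \<open>k\<close> and \<open>E\<close> alone, hence the same for all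
    configurations.\<close>
  obtain p where p: "\<And>j s. s \<in> {- (2 * real k)..2 * real k} \<Longrightarrow> \<bar>poly (p j) s\<bar> \<le> 2"
    "\<And>s. s \<in> {- (2 * real k)..2 * real k} \<Longrightarrow> (\<lambda>j. poly (p j) s) \<longlonglongrightarrow> indicator {..E} s"
    using indicator_atMost_poly_approx[of "2 * real k" E] by blast
  define m where "m \<omega> i = (lapop t k (W \<omega>) (adj \<omega>) ^^ i) (indicator {x}) x" for \<omega> i
  show ?thesis
  proof (rule borel_measurable_LIMSEQ_real)
    fix \<omega>
    interpret g: bounded_degree_graph "W \<omega>" "adj \<omega>" k by (rule graph)
    show "(\<lambda>j. if x \<in> W \<omega> then mfun (m \<omega>) (p j) else 0) \<longlonglongrightarrow>
       (if x \<in> W \<omega> then measure (spectral_measure t k (W \<omega>) (adj \<omega>) x) {..E} else 0)"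
    proof (cases "x \<in> W \<omega>")
      case True
      have "m \<omega> = g.lap_moment t x" by (auto simp: m_def g.lap_moment_def)
      moreover have "AE s in spectral_measure t k (W \<omega>) (adj \<omega>) x. s \<in> {- (2 * real k)..2 * real k}"
        using g.spectral_measure(2)[OF True k_pos] by (rule AE_mp) auto
      ultimately show ?thesis
        using True real_distribution.measure_atMost_limit[OF g.spectral_measure(1)[OF True k_pos] _
            g.spectral_measure(3)[OF True k_pos] p] by simp
    qed simp
  next
    have "(\<lambda>\<omega>. m \<omega> i) \<in> borel_measurable M" for i
      unfolding m_def by measurable
    then show "(\<lambda>\<omega>. if x \<in> W \<omega> then mfun (m \<omega>) (p j) else 0) \<in> borel_measurable M" for j
      unfolding mfun_def by measurable
  qed
qed

text \<open>On \<open>F\<close> the atom contributes at least \<open>a\<close> to the increment of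
  the distribution function; elsewhere monotonicity suffices.\<close>

lemma expected_spectral_gap_ge:
  assumes E: "lam > 0" "lam \<le> E" and F: "F \<in> events" "a \<ge> 0"
    and atom: "\<And>\<omega>. \<omega> \<in> F \<Longrightarrow> x \<in> W \<omega> \<and> measure (spectral_measure t k (W \<omega>) (adj \<omega>) x) {lam} \<ge> a"
  shows "(\<integral>\<omega>. (if x \<in> W \<omega> then measure (spectral_measure t k (W \<omega>) (adj \<omega>) x) {..E} else 0) \<partial>M)
       - (\<integral>\<omega>. (if x \<in> W \<omega> then measure (spectral_measure t k (W \<omega>) (adj \<omega>) x) {..0} else 0) \<partial>M)
       \<ge> a * prob F"
proof -
  define f where "f E \<omega> = (if x \<in> W \<omega> then measure (spectral_measure t k (W \<omega>) (adj \<omega>) x) {..E} else 0)" for E \<omega>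
  have rd: "real_distribution (spectral_measure t k (W \<omega>) (adj \<omega>) x)" if "x \<in> W \<omega>" for \<omega>
    using bounded_degree_graph.spectral_measure(1)[OF graph that k_pos] .
  have f_bd: "norm (f E \<omega>) \<le> 1" for E \<omega>
    unfolding f_def using prob_space.prob_le_1[OF real_distribution.axioms(1)[OF rd]] by auto
  have [measurable]: "f E \<in> borel_measurable M" for E
    unfolding f_def by measurable
  \<comment> \<open>A non-integrable function would have Bochner integral 0 by default, so comparing
    the two expectations depends on this.\<close>
  have int: "integrable M (f E)" for E
    by (rule integrable_const_bound[of _ 1]) (simp_all add: f_bd[simplified])
  have diff: "f 0 \<omega> + a * indicator F \<omega> \<le> f E \<omega>" for \<omega>
  proof (cases "x \<in> W \<omega>")
    case True
    interpret mu: real_distribution "spectral_measure t k (W \<omega>) (adj \<omega>) x" by (rule rd[OF True])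
    have "measure (spectral_measure t k (W \<omega>) (adj \<omega>) x) {..0} +
        measure (spectral_measure t k (W \<omega>) (adj \<omega>) x) {lam} =
        measure (spectral_measure t k (W \<omega>) (adj \<omega>) x) ({..0} \<union> {lam})"
      using E by (subst mu.finite_measure_Union) auto
    also have "\<dots> \<le> measure (spectral_measure t k (W \<omega>) (adj \<omega>) x) {..E}"
      using E by (intro mu.finite_measure_mono) auto
    finally have "measure (spectral_measure t k (W \<omega>) (adj \<omega>) x) {..0} +
        measure (spectral_measure t k (W \<omega>) (adj \<omega>) x) {lam} \<le> measure (spectral_measure t k (W \<omega>) (adj \<omega>) x) {..E}" .
    moreover have "measure (spectral_measure t k (W \<omega>) (adj \<omega>) x) {..0} \<le>
        measure (spectral_measure t k (W \<omega>) (adj \<omega>) x) {..E}"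
      using E by (intro mu.finite_measure_mono) auto
    ultimately show ?thesis
      using True atom[of \<omega>]
      by (cases "\<omega> \<in> F") (auto simp: f_def)
  next
    case False
    then show ?thesis using atom[of \<omega>] by (auto simp: f_def indicator_def)
  qed
  have "integral\<^sup>L M (f 0) + a * prob F = (\<integral>\<omega>. f 0 \<omega> + a * indicator F \<omega> \<partial>M)"
    using F int by (subst Bochner_Integration.integral_add) (auto simp: emeasure_eq_measure)
  also have "\<dots> \<le> integral\<^sup>L M (f E)"
    using F int diff by (intro integral_mono) (auto simp: emeasure_eq_measure)
  finally show ?thesis unfolding f_def by simp
qed

end

section \<open>Cylinder events of Bernoulli product measures\<close>

lemma prob_fixed_pattern:
  assumes p: "0 < p" "p < 1" and J: "finite J" "J \<subseteq> I"
  defines "M \<equiv> PiM I (\<lambda>_. measure_pmf (bernoulli_pmf p))"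
  shows "{\<omega> \<in> space M. \<forall>i\<in>J. \<omega> i = b i} \<in> sets M"
    and "measure M {\<omega> \<in> space M. \<forall>i\<in>J. \<omega> i = b i} \<ge> (min p (1 - p)) ^ card J"
proof -
  interpret product_prob_space "\<lambda>_. measure_pmf (bernoulli_pmf p)" I ..
  show "{\<omega> \<in> space M. \<forall>i\<in>J. \<omega> i = b i} \<in> sets M"
    unfolding M_def
    by (rule sets.sets_Collect_finite_All[OF _ J(1)], rule sets_Collect_single') (use J in auto)
  have "emeasure M {\<omega> \<in> space M. \<forall>i\<in>J. \<omega> i \<in> {b i}} = (\<Prod>i\<in>J. emeasure (measure_pmf (bernoulli_pmf p)) {b i})"
    unfolding M_def by (rule emeasure_PiM_Collect) (use J in auto)
  then have "measure M {\<omega> \<in> space M. \<forall>i\<in>J. \<omega> i = b i} = (\<Prod>i\<in>J. measure (measure_pmf (bernoulli_pmf p)) {b i})"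
    by (simp add: measure_def emeasure_pmf_single prod_ennreal prod_nonneg measure_pmf_single)
  \<comment> \<open>One coordinate has probability p or 1 - p; the minimum covers open and closed
    coordinates alike.\<close>
  also have "\<dots> \<ge> (\<Prod>i\<in>J. min p (1 - p))"
  proof (rule prod_mono)
    fix i
    show "0 \<le> min p (1 - p) \<and> min p (1 - p) \<le> measure (measure_pmf (bernoulli_pmf p)) {b i}"
      using p by (cases "b i") (auto simp: measure_pmf_single)
  qed
  finally show "measure M {\<omega> \<in> space M. \<forall>i\<in>J. \<omega> i = b i} \<ge> (min p (1 - p)) ^ card J"
    by simp
qed

section \<open>Percolation clusters in Cayley graphs\<close>

locale cayley_graph = group G for G :: "('a, 'b) monoid_scheme" (structure) +
  fixes S :: "'a set"
  assumes gen: "fin_gen_set G S"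
begin

lemma S_props: "finite S" "S \<subseteq> carrier G" "\<one> \<notin> S" "\<And>s. s \<in> S \<Longrightarrow> inv s \<in> S" "generate G S = carrier G"
  using gen unfolding fin_gen_set_def by auto

lemma cay_carrier: "cay G S x y \<Longrightarrow> x \<in> carrier G" "cay G S x y \<Longrightarrow> y \<in> carrier G"
  by (auto simp: cay_def)

lemma cay_sym: "cay G S x y \<Longrightarrow> cay G S y x"
proof -
  assume "cay G S x y"
  then obtain s where s: "x \<in> carrier G" "y \<in> carrier G" "s \<in> S" "y = x \<otimes> s"
    unfolding cay_def by blast
  then have "x = y \<otimes> inv s"
    using S_props(2) by (simp add: inv_solve_right subset_iff)
  then show ?thesis using s S_props(4) unfolding cay_def by blast
qed

lemma cay_irrefl: "\<not> cay G S x x"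
proof
  assume "cay G S x x"
  then obtain s where s: "x \<in> carrier G" "s \<in> S" "x \<otimes> s = x" by (auto simp: cay_def)
  then have "x \<otimes> s = x \<otimes> \<one>" by simp
  then have "s = \<one>" using s S_props(2) Units_l_cancel[of x s \<one>] by auto
  then show False using s S_props(3) by simp
qed

lemma cay_nbrs: "x \<in> carrier G \<Longrightarrow> {y. cay G S x y} = (\<lambda>s. x \<otimes> s) ` S"
  using S_props(2) by (auto simp: cay_def)

lemma finite_cay_nbrs: "finite {y. cay G S x y}"
proof (cases "x \<in> carrier G")
  case False
  then have "{y. cay G S x y} = {}" by (auto simp: cay_def)
  then show ?thesis by simp
qed (simp add: cay_nbrs S_props)

lemma card_cay_nbrs: "x \<in> carrier G \<Longrightarrow> card {y. cay G S x y} = card S"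
proof (subst cay_nbrs)
  assume x: "x \<in> carrier G"
  have "inj_on (\<lambda>s. x \<otimes> s) S"
    by (rule inj_onI) (use x S_props(2) in \<open>metis Units_eq Units_l_cancel subsetD\<close>)
  then show "card ((\<lambda>s. x \<otimes> s) ` S) = card S" by (rule card_image)
qed

lemma card_cay_nbrs_le: "card {y. cay G S x y} \<le> card S"
proof (cases "x \<in> carrier G")
  case False
  then have "{y. cay G S x y} = {}" by (auto simp: cay_def)
  then show ?thesis by simp
qed (simp add: card_cay_nbrs)

lemma subgraph_bounded_degree:
  assumes "\<And>x y. adj x y \<Longrightarrow> adj y x" "\<And>x y. adj x y \<Longrightarrow> x \<in> W" "\<And>x y. adj x y \<Longrightarrow> cay G S x y"
  shows "bounded_degree_graph W adj (card S)"
proof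
  fix x
  have sub: "{y. adj x y} \<subseteq> {y. cay G S x y}" using assms(3) by auto
  show "finite {y. adj x y}" by (rule finite_subset[OF sub finite_cay_nbrs])
  show "card {y. adj x y} \<le> card S"
    using card_mono[OF finite_cay_nbrs sub] card_cay_nbrs_le[of x] by simp
qed (use assms in auto)

lemma bounded_degree_cay: "bounded_degree_graph (carrier G) (cay G S) (card S)"
  by (rule subgraph_bounded_degree) (auto intro: cay_sym cay_carrier)

lemma bounded_degree_induced:
  "bounded_degree_graph K (\<lambda>x y. x \<in> K \<and> y \<in> K \<and> cay G S x y) (card S)"
  by (rule subgraph_bounded_degree) (auto intro: cay_sym)

lemma bounded_degree_site: "bounded_degree_graph (site_W G \<omega>) (site_adj G S \<omega>) (card S)"
  by (rule subgraph_bounded_degree) (auto simp: site_adj_def site_W_def intro: cay_sym cay_carrier)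

lemma bounded_degree_bond: "bounded_degree_graph (bond_W G S \<omega>) (bond_adj G S \<omega>) (card S)"
  by (rule subgraph_bounded_degree) (auto simp: bond_adj_def bond_W_def insert_commute intro: cay_sym)

text \<open>Generators are appended on the right, so the path for \<open>h2\<close> starts where the
  one for \<open>h1\<close> ends; the induction therefore varies the starting point. Inverses of
  generators are again steps by the symmetry of \<open>S\<close>.\<close>

lemma cay_reachable:
  assumes "g \<in> carrier G" "x \<in> carrier G"
  shows "(x, x \<otimes> g) \<in> {(u, v). cay G S u v}\<^sup>*"
proof -
  have step: "(x, x \<otimes> s) \<in> {(u, v). cay G S u v}" if "x \<in> carrier G" "s \<in> S" for x s
    using that S_props(2) by (auto simp: cay_def)
  have "g \<in> generate G S" using assms S_props by simp
  then show ?thesis using assms(2)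
  proof (induction g arbitrary: x)
    case (eng h1 h2)
    have h: "h1 \<in> carrier G" "h2 \<in> carrier G"
      using eng.hyps S_props(5) by auto
    have "(x, x \<otimes> h1) \<in> {(u, v). cay G S u v}\<^sup>*" "(x \<otimes> h1, x \<otimes> h1 \<otimes> h2) \<in> {(u, v). cay G S u v}\<^sup>*"
      by (rule eng.IH, use eng.prems h in simp)+
    then have "(x, x \<otimes> h1 \<otimes> h2) \<in> {(u, v). cay G S u v}\<^sup>*" by (rule rtrancl_trans)
    then show ?case using h eng.prems by (simp only: m_assoc)
  next
    case one
    then show ?case by simp
  next
    case (incl h)
    then show ?case using step by blast
  next
    case (inv h)
    then show ?case using step S_props(4) by blast
  qed
qed

text \<open>Connectedness in the form that the maximum principle in
  \<open>zero_not_eigenvalue\<close> uses.\<close>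

lemma cay_closed_eq_carrier:
  assumes "U \<subseteq> carrier G" "u \<in> U" "\<And>x y. x \<in> U \<Longrightarrow> cay G S x y \<Longrightarrow> y \<in> U"
  shows "U = carrier G"
proof (rule antisym)
  have closed: "(x, y) \<in> {(u, v). cay G S u v}\<^sup>* \<Longrightarrow> x \<in> U \<Longrightarrow> y \<in> U" for x y
    by (induction rule: rtrancl_induct) (use assms(3) in auto)
  show "carrier G \<subseteq> U"
  proof
    fix z assume z: "z \<in> carrier G"
    have u: "u \<in> carrier G" using assms by auto
    have "u \<otimes> (inv u \<otimes> z) = z" using u z by (simp add: m_assoc[symmetric])
    then have "(u, z) \<in> {(u, v). cay G S u v}\<^sup>*"
      using cay_reachable[of "inv u \<otimes> z" u] u z by simp
    then show "z \<in> U" using closed assms(2) by blast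
  qed
qed fact

text \<open>Edges come from right multiplication, so left multiplication acts by
  automorphisms.\<close>

lemma cay_translate:
  assumes "g \<in> carrier G" "x \<in> carrier G" "y \<in> carrier G"
  shows "cay G S (g \<otimes> x) (g \<otimes> y) \<longleftrightarrow> cay G S x y"
  unfolding cay_def using assms S_props(2) by (auto simp: m_assoc subset_iff)

lemma component_measurable:
  "i \<in> I \<Longrightarrow> Measurable.pred (PiM I (\<lambda>_. measure_pmf q)) (\<lambda>\<omega>. \<omega> i)"
  using measurable_component_singleton[of i I "\<lambda>_. measure_pmf q"] by simp

lemma random_graph_site:
  assumes "card S > 0"
  shows "random_graph (site_perc G p) (site_W G) (site_adj G S) (card S) (\<lambda>x. {y. cay G S x y})"
proof (intro random_graph.intro random_graph_axioms.intro)
  show "prob_space (site_perc G p)"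
    unfolding site_perc_def by (intro prob_space_PiM prob_space_measure_pmf)
  have *: "Measurable.pred (site_perc G p) (\<lambda>\<omega>. \<omega> x)" if "x \<in> carrier G" for x
    using that unfolding site_perc_def by (rule component_measurable)
  show "Measurable.pred (site_perc G p) (\<lambda>\<omega>. x \<in> site_W G \<omega>)" for x
    unfolding site_W_def by (cases "x \<in> carrier G") (simp_all add: *)
  show "Measurable.pred (site_perc G p) (\<lambda>\<omega>. site_adj G S \<omega> x y)" for x y
  proof (cases "cay G S x y")
    case True
    note [measurable] = *[OF cay_carrier(1)[OF True]] *[OF cay_carrier(2)[OF True]]
    show ?thesis unfolding site_adj_def by measurable
  qed (simp add: site_adj_def)
qed (use assms in \<open>auto simp: bounded_degree_site finite_cay_nbrs site_adj_def\<close>)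

lemma random_graph_bond:
  assumes "card S > 0"
  shows "random_graph (bond_perc G S p) (bond_W G S) (bond_adj G S) (card S) (\<lambda>x. {y. cay G S x y})"
proof (intro random_graph.intro random_graph_axioms.intro)
  show "prob_space (bond_perc G S p)"
    unfolding bond_perc_def by (intro prob_space_PiM prob_space_measure_pmf)
  show adj: "Measurable.pred (bond_perc G S p) (\<lambda>\<omega>. bond_adj G S \<omega> x y)" for x y
  proof (cases "cay G S x y")
    case True
    then have "{x, y} \<in> cay_edges G S" unfolding cay_edges_def by blast
    then have [measurable]: "Measurable.pred (bond_perc G S p) (\<lambda>\<omega>. \<omega> {x, y})"
      unfolding bond_perc_def by (rule component_measurable)
    show ?thesis unfolding bond_adj_def by measurable
  qed (simp add: bond_adj_def)
  have "x \<in> bond_W G S \<omega> \<longleftrightarrow> (\<exists>y\<in>{y. cay G S x y}. bond_adj G S \<omega> x y)" for x \<omega>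
    by (auto simp: bond_W_def bond_adj_def)
  then show "Measurable.pred (bond_perc G S p) (\<lambda>\<omega>. x \<in> bond_W G S \<omega>)" for x
    using adj by (simp only:) (intro pred_intros_finite finite_cay_nbrs, auto)
qed (use assms in \<open>auto simp: bounded_degree_bond finite_cay_nbrs bond_adj_def\<close>)

section \<open>Isolated clusters and the spectral mass they force\<close>

lemma cluster_eigenvector:
  assumes g: "bounded_degree_graph W adj (card S)" and K: "K \<subseteq> W"
    and adj: "\<And>x y. x \<in> K \<Longrightarrow> adj x y \<longleftrightarrow> y \<in> K \<and> cay G S x y"
    and \<phi>: "\<And>y. y \<notin> K \<Longrightarrow> \<phi> y = 0" "\<And>y. y \<in> K \<Longrightarrow> lapop t (card S) K (cay G S) \<phi> y = lam * \<phi> y"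
  shows "lapop t (card S) W adj \<phi> y = lam * \<phi> y"
proof (cases "y \<in> K")
  case True
  then have "{z \<in> W. adj y z} = {z \<in> K. cay G S y z}" using adj K by auto
  then have "lapop t (card S) W adj \<phi> y = lapop t (card S) K (cay G S) \<phi> y"
    using True K by (cases t) (auto simp: lapop_def gdeg_def adjop_def)
  with \<phi>(2)[OF True] show ?thesis by simp
next
  case False
  \<comment> \<open>A neighbour \<open>z\<close> in \<open>K\<close> would, by symmetry and the
    assumption on \<open>adj\<close>, have put \<open>y\<close> into \<open>K\<close>. So points
    outside see only zeros.\<close>
  have "\<phi> z = 0" if "adj y z" for z
    using False adj[of z y] \<phi>(1)[of z] bounded_degree_graph.adj_sym[OF g that] by blast
  then show ?thesis
    using \<phi>(1)[OF False] by (simp add: bounded_degree_graph.lapop_altdef[OF g])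
qed

text \<open>With the maximum at the identity, phi(1)^2 is at least the fraction 1/|K| of the squared
  norm. The exponent bounds the number of prescribed states: \<open>K\<close> and its neighbours for
  sites, the edges meeting \<open>K\<close> for bonds. \<open>nbr\<close> makes \<open>S\<close>
  non-empty and puts \<open>K\<close> into \<open>bond_W\<close>, which contains no isolated
  vertices.\<close>

lemma IDS_gap_of_cluster_at_one:
  assumes p: "0 < p" "p < 1" and K: "finite K" "K \<subseteq> carrier G" "\<one> \<in> K"
    and nbr: "\<And>x. x \<in> K \<Longrightarrow> \<exists>y\<in>K. cay G S x y"
    and \<phi>: "\<And>y. y \<notin> K \<Longrightarrow> \<phi> y = 0" "\<And>y. y \<in> K \<Longrightarrow> lapop t (card S) K (cay G S) \<phi> y = lam * \<phi> y"
    and max: "\<phi> \<one> \<noteq> 0" "\<And>y. y \<in> K \<Longrightarrow> (\<phi> y)\<^sup>2 \<le> (\<phi> \<one>)\<^sup>2"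
    and E: "lam > 0" "lam \<le> E"
  shows "IDS pt t G S p E - IDS pt t G S p 0 \<ge> 1 / real (card K) * (min p (1 - p)) ^ (Suc (card S) * card K)"
proof -
  define r where "r = min p (1 - p)"
  have r: "0 < r" "r \<le> 1" using p by (auto simp: r_def)
  define a where "a = 1 / real (card K)"
  have cK: "card K > 0" using K by (auto simp: card_gt_0_iff)
  then have a: "a \<ge> 0" by (simp add: a_def)
  obtain y0 where "cay G S \<one> y0" using nbr K(3) by blast
  then have k: "card S > 0" using S_props(1) by (auto simp: cay_def card_gt_0_iff)
  have ratio: "a \<le> (\<phi> \<one>)\<^sup>2 / (\<Sum>y\<in>K. (\<phi> y)\<^sup>2)"
  proof -
    have "(\<Sum>y\<in>K. (\<phi> y)\<^sup>2) \<le> real (card K) * (\<phi> \<one>)\<^sup>2"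
      using sum_bounded_above[of K "\<lambda>y. (\<phi> y)\<^sup>2" "(\<phi> \<one>)\<^sup>2"] max(2) by simp
    moreover have "(\<Sum>y\<in>K. (\<phi> y)\<^sup>2) > 0"
      using max(1) K by (intro sum_pos2[of _ \<one>]) auto
    ultimately show ?thesis using cK by (simp add: a_def field_simps)
  qed
  have nbrs_card: "card (\<Union>x\<in>K. f x ` {y. cay G S x y}) \<le> card S * card K"
    "finite (\<Union>x\<in>K. f x ` {y. cay G S x y})" for f :: "'a \<Rightarrow> 'a \<Rightarrow> 'c"
  proof -
    have "card (\<Union>x\<in>K. f x ` {y. cay G S x y}) \<le> (\<Sum>x\<in>K. card (f x ` {y. cay G S x y}))"
      by (rule card_UN_le[OF K(1)])
    also have "\<dots> \<le> (\<Sum>x\<in>K. card S)"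
      by (intro sum_mono order_trans[OF card_image_le[OF finite_cay_nbrs] card_cay_nbrs_le])
    finally show "card (\<Union>x\<in>K. f x ` {y. cay G S x y}) \<le> card S * card K" by (simp add: mult.commute)
    show "finite (\<Union>x\<in>K. f x ` {y. cay G S x y})" using K(1) finite_cay_nbrs by auto
  qed
  have pow: "a * r ^ (Suc (card S) * card K) \<le> a * measure M F"
    if "measure M F \<ge> r ^ card J" "card J \<le> Suc (card S) * card K" for M :: "'w measure" and F and J :: "'v set"
    using a that r order_trans[OF power_decreasing[OF that(2), of r] that(1)] by (intro mult_left_mono) auto
  show ?thesis
  proof (cases pt)
    case Site
    interpret random_graph "site_perc G p" "site_W G" "site_adj G S" "card S" "\<lambda>x. {y. cay G S x y}"
      by (rule random_graph_site[OF k])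
    \<comment> \<open>The image under the identity map fits the counting fact
      \<open>nbrs_card\<close>, which serves edges as well.\<close>
    define J where "J = K \<union> (\<Union>x\<in>K. (\<lambda>y. y) ` {y. cay G S x y})"
    have J: "finite J" "J \<subseteq> carrier G" using K finite_cay_nbrs by (auto simp: J_def intro: cay_carrier)
    have cJ: "card J \<le> Suc (card S) * card K"
      unfolding J_def using order_trans[OF card_Un_le add_left_mono[OF nbrs_card(1)], of K "\<lambda>_ y. y"] by simp
    \<comment> \<open>\<open>K\<close> is open and its outer boundary is closed.\<close>
    define F where "F = {\<omega> \<in> space (site_perc G p). \<forall>i\<in>J. \<omega> i = (i \<in> K)}"
    have F: "F \<in> events" "r ^ card J \<le> prob F"
      unfolding F_def r_def site_perc_def by (rule prob_fixed_pattern[OF p J])+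
    have "\<one> \<in> site_W G \<omega> \<and> a \<le> measure (spectral_measure t (card S) (site_W G \<omega>) (site_adj G S \<omega>) \<one>) {lam}"
      if "\<omega> \<in> F" for \<omega>
    proof -
      have J_eq: "\<omega> i \<longleftrightarrow> i \<in> K" if "i \<in> J" for i using that \<open>\<omega> \<in> F\<close> by (auto simp: F_def)
      have KW: "K \<subseteq> site_W G \<omega>" using K J_eq by (auto simp: site_W_def J_def)
      have adj: "site_adj G S \<omega> x y \<longleftrightarrow> y \<in> K \<and> cay G S x y" if "x \<in> K" for x y
        using that J_eq[of x] J_eq[of y] by (auto simp: site_adj_def J_def)
      have "lapop t (card S) (site_W G \<omega>) (site_adj G S \<omega>) \<phi> y = lam * \<phi> y" for y
        using bounded_degree_site KW adj \<phi> by (rule cluster_eigenvector)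
      then have "(\<phi> \<one>)\<^sup>2 / (\<Sum>y\<in>K. (\<phi> y)\<^sup>2)
          \<le> measure (spectral_measure t (card S) (site_W G \<omega>) (site_adj G S \<omega>) \<one>) {lam}"
        using k K KW \<phi>(1) max(1)
        by (intro bounded_degree_graph.spectral_measure_eigenvector[OF bounded_degree_site]) auto
      then show ?thesis using ratio KW K by auto
    qed
    from expected_spectral_gap_ge[OF E F(1) a this] pow[OF F(2) cJ]
    show ?thesis unfolding Site IDS_def by (simp add: a_def r_def)
  next
    case Bond
    interpret random_graph "bond_perc G S p" "bond_W G S" "bond_adj G S" "card S" "\<lambda>x. {y. cay G S x y}"
      by (rule random_graph_bond[OF k])
    define J where "J = (\<Union>x\<in>K. (\<lambda>y. {x, y}) ` {y. cay G S x y})"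
    have J: "finite J" "J \<subseteq> cay_edges G S" using nbrs_card(2) by (auto simp: J_def cay_edges_def)
    have cJ: "card J \<le> Suc (card S) * card K"
      unfolding J_def using nbrs_card(1)[of "\<lambda>x y. {x, y}"] by simp
    \<comment> \<open>Among the edges meeting \<open>K\<close>, those inside are open and those
      leaving are closed.\<close>
    define F where "F = {\<omega> \<in> space (bond_perc G S p). \<forall>e\<in>J. \<omega> e = (e \<subseteq> K)}"
    have F: "F \<in> events" "r ^ card J \<le> prob F"
      unfolding F_def r_def bond_perc_def
      by (rule prob_fixed_pattern[OF p J, where b = "\<lambda>e. e \<subseteq> K"])+
    have "\<one> \<in> bond_W G S \<omega> \<and> a \<le> measure (spectral_measure t (card S) (bond_W G S \<omega>) (bond_adj G S \<omega>) \<one>) {lam}"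
      if "\<omega> \<in> F" for \<omega>
    proof -
      have J_eq: "\<omega> e \<longleftrightarrow> e \<subseteq> K" if "e \<in> J" for e using that \<open>\<omega> \<in> F\<close> by (auto simp: F_def)
      have adj: "bond_adj G S \<omega> x y \<longleftrightarrow> y \<in> K \<and> cay G S x y" if "x \<in> K" for x y
        using that J_eq[of "{x, y}"] by (auto simp: bond_adj_def J_def)
      have KW: "K \<subseteq> bond_W G S \<omega>" using nbr adj by (fastforce simp: bond_W_def)
      have "lapop t (card S) (bond_W G S \<omega>) (bond_adj G S \<omega>) \<phi> y = lam * \<phi> y" for y
        using bounded_degree_bond KW adj \<phi> by (rule cluster_eigenvector)
      then have "(\<phi> \<one>)\<^sup>2 / (\<Sum>y\<in>K. (\<phi> y)\<^sup>2)
          \<le> measure (spectral_measure t (card S) (bond_W G S \<omega>) (bond_adj G S \<omega>) \<one>) {lam}"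
        using k K KW \<phi>(1) max(1)
        by (intro bounded_degree_graph.spectral_measure_eigenvector[OF bounded_degree_bond]) auto
      then show ?thesis using ratio KW K by auto
    qed
    from expected_spectral_gap_ge[OF E F(1) a this] pow[OF F(2) cJ]
    show ?thesis unfolding Bond IDS_def by (simp add: a_def r_def)
  qed
qed

lemma IDS_gap_of_cluster:
  assumes p: "0 < p" "p < 1" and K: "finite K" "K \<subseteq> carrier G"
    and nbr: "\<And>x. x \<in> K \<Longrightarrow> \<exists>y\<in>K. cay G S x y"
    and eig: "is_eigenvalue t (card S) K (cay G S) lam"
    and E: "lam > 0" "lam \<le> E"
  shows "IDS pt t G S p E - IDS pt t G S p 0 \<ge> 1 / real (card K) * (min p (1 - p)) ^ (Suc (card S) * card K)"
proof -
  obtain \<phi> x where \<phi>: "x \<in> K" "\<phi> x \<noteq> 0" "\<And>y. y \<in> K \<Longrightarrow> lapop t (card S) K (cay G S) \<phi> y = lam * \<phi> y"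
    using eig unfolding is_eigenvalue_def by blast
  obtain x0 where x0: "x0 \<in> K" "\<And>y. y \<in> K \<Longrightarrow> (\<phi> y)\<^sup>2 \<le> (\<phi> x0)\<^sup>2"
  proof -
    have "Max ((\<lambda>y. (\<phi> y)\<^sup>2) ` K) \<in> (\<lambda>y. (\<phi> y)\<^sup>2) ` K" using K \<phi>(1) by (intro Max_in) auto
    then obtain x0 where "x0 \<in> K" "(\<phi> x0)\<^sup>2 = Max ((\<lambda>y. (\<phi> y)\<^sup>2) ` K)" by auto
    then show ?thesis using K(1) that by simp
  qed
  have "(\<phi> x)\<^sup>2 > 0" using \<phi>(2) by simp
  then have nz: "\<phi> x0 \<noteq> 0" using x0(2)[OF \<phi>(1)] by auto
  define g where "g = inv x0"
  have gc: "g \<in> carrier G" "x0 \<in> carrier G" using x0 K by (auto simp: g_def)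
  define \<tau> where "\<tau> y = g \<otimes> y" for y
  have retract: "x0 \<otimes> \<tau> y = y" if "y \<in> carrier G" for y
    unfolding \<tau>_def g_def using gc that by (simp add: m_assoc[symmetric])
  have inj: "inj_on \<tau> K" using K retract by (metis inj_onI subsetD)
  \<comment> \<open>The transported eigenvector. Zero is imposed off the cluster because
    \<open>is_eigenvalue\<close> leaves the values outside \<open>K\<close> arbitrary.\<close>
  define \<psi> where "\<psi> y = (if y \<in> \<tau> ` K then \<phi> (x0 \<otimes> y) else 0)" for y
  have \<psi>: "\<psi> (\<tau> y) = \<phi> y" if "y \<in> K" for y using that K retract by (auto simp: \<psi>_def)
  have cay: "cay G S (\<tau> x) (\<tau> y) \<longleftrightarrow> cay G S x y" if "x \<in> K" "y \<in> K" for x y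
    using that K cay_translate[OF gc(1)] by (auto simp: \<tau>_def subset_iff)
  have \<tau>0: "\<tau> x0 = \<one>" using gc by (simp add: \<tau>_def g_def)
  have nbrs: "{z \<in> \<tau> ` K. cay G S (\<tau> y) z} = \<tau> ` {z \<in> K. cay G S y z}" if "y \<in> K" for y
    using that cay by auto
  have lap: "lapop t (card S) (\<tau> ` K) (cay G S) \<psi> (\<tau> y) = lapop t (card S) K (cay G S) \<phi> y" if y: "y \<in> K" for y
  proof -
    have inj': "inj_on \<tau> {z \<in> K. cay G S y z}" by (rule inj_on_subset[OF inj]) auto
    have "gdeg (\<tau> ` K) (cay G S) (\<tau> y) = gdeg K (cay G S) y"
      unfolding gdeg_def nbrs[OF y] by (simp add: card_image[OF inj'])
    moreover have "adjop (\<tau> ` K) (cay G S) \<psi> (\<tau> y) = adjop K (cay G S) \<phi> y"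
      unfolding adjop_def nbrs[OF y] sum.reindex[OF inj'] by (intro sum.cong) (auto simp: \<psi>)
    ultimately show ?thesis using y by (cases t) (simp_all add: lapop_def \<psi>)
  qed
  have "IDS pt t G S p E - IDS pt t G S p 0
      \<ge> 1 / real (card (\<tau> ` K)) * (min p (1 - p)) ^ (Suc (card S) * card (\<tau> ` K))"
  proof (rule IDS_gap_of_cluster_at_one[OF p, where \<phi> = \<psi> and lam = lam and K = "\<tau> ` K"])
    show "\<tau> ` K \<subseteq> carrier G" using K gc by (auto simp: \<tau>_def)
    show "\<one> \<in> \<tau> ` K" using x0 \<tau>0 by force
    show "\<exists>y\<in>\<tau> ` K. cay G S x y" if "x \<in> \<tau> ` K" for x using that nbr cay by fastforce
    show "\<psi> y = 0" if "y \<notin> \<tau> ` K" for y using that by (simp add: \<psi>_def)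
    show "lapop t (card S) (\<tau> ` K) (cay G S) \<psi> y = lam * \<psi> y" if "y \<in> \<tau> ` K" for y
      using that lap \<phi>(3) \<psi> by auto
    show "\<psi> \<one> \<noteq> 0" using \<psi>[OF x0(1)] nz \<tau>0 by simp
    show "(\<psi> y)\<^sup>2 \<le> (\<psi> \<one>)\<^sup>2" if "y \<in> \<tau> ` K" for y
      using that x0 \<psi> \<psi>[OF x0(1)] \<tau>0 by auto
  qed (use K E in auto)
  then show ?thesis by (simp add: card_image[OF inj])
qed

end

section \<open>Eigenvalues of Laplacians of finite graphs\<close>

text \<open>The first-order condition at a minimum, for the variational argument that
  follows.\<close>

lemma quadratic_nonneg_linear_coeff_zero:
  fixes b c :: real
  assumes "\<And>s. 2 * s * b + s\<^sup>2 * c \<ge> 0"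
  shows "b = 0"
proof (rule ccontr)
  assume b: "b \<noteq> 0"
  \<comment> \<open>At s = -b/d the expression equals b^2 (c - 2d) / d^2, which is negative since d
    > |c|.\<close>
  define d where "d = \<bar>c\<bar> + 1"
  have d: "d > 0" by (simp add: d_def)
  have "2 * (- b / d) * b + (- b / d)\<^sup>2 * c \<ge> 0" by (rule assms)
  then have ge: "(2 * (- b / d) * b + (- b / d)\<^sup>2 * c) * d\<^sup>2 \<ge> 0" by simp
  have "(2 * (- b / d) * b + (- b / d)\<^sup>2 * c) * d\<^sup>2 = b\<^sup>2 * (c - 2 * d)"
    using d by (simp add: field_simps power2_eq_square)
  with ge have "b\<^sup>2 * (c - 2 * d) \<ge> 0" by simp
  then have "c - 2 * d \<ge> 0" using b by (simp add: zero_le_mult_iff)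
  then show False by (simp add: d_def)
qed

text \<open>Minimises the Rayleigh quotient over the unit sphere; the minimum is attained by
  compactness and the minimiser is an eigenvector.\<close>

lemma symmetric_form_min_eigenvector:
  fixes B :: "'a \<Rightarrow> 'a \<Rightarrow> real"
  assumes K: "finite K" "K \<noteq> {}" and sym: "\<And>x y. x \<in> K \<Longrightarrow> y \<in> K \<Longrightarrow> B x y = B y x"
  obtains lam \<phi> where "\<exists>x\<in>K. \<phi> x \<noteq> 0" "\<And>x. x \<in> K \<Longrightarrow> (\<Sum>y\<in>K. B x y * \<phi> y) = lam * \<phi> x"
    "\<And>\<psi>. (\<Sum>x\<in>K. \<Sum>y\<in>K. B x y * \<psi> y * \<psi> x) \<ge> lam * (\<Sum>x\<in>K. (\<psi> x)\<^sup>2)"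
proof -
  define Q where "Q \<psi> = (\<Sum>x\<in>K. \<Sum>y\<in>K. B x y * \<psi> y * \<psi> x)" for \<psi> :: "'a \<Rightarrow> real"
  define N where "N \<psi> = (\<Sum>x\<in>K. (\<psi> x)\<^sup>2)" for \<psi> :: "'a \<Rightarrow> real"
  \<comment> \<open>Vectors are functions on the whole type. Pinning the coordinates outside
    \<open>K\<close> to 0 makes this cube compact in the product topology, and it contains the unit
    sphere.\<close>
  define P where "P = PiE UNIV (\<lambda>x. if x \<in> K then {-1..1} else {0::real})"
  have "compactin (product_topology (\<lambda>_. euclidean) UNIV) P"
    unfolding P_def by (subst compactin_PiE) auto
  then have "compact P" by (simp add: euclidean_product_topology)
  have contN: "continuous_on UNIV N"
    unfolding N_def by (intro continuous_intros continuous_on_product_coordinates)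
  have contQ: "continuous_on UNIV Q"
    unfolding Q_def by (intro continuous_intros continuous_on_product_coordinates)
  define C where "C = P \<inter> {\<psi>. N \<psi> = 1}"
  have "compact C"
    unfolding C_def using \<open>compact P\<close> contN by (intro compact_Int_closed closed_Collect_eq) auto
  have N_in: "(\<lambda>x. if x \<in> K then \<psi> x else 0) \<in> C" if "N \<psi> = 1" for \<psi>
  proof -
    have "\<bar>\<psi> x\<bar> \<le> 1" if "x \<in> K" for x
    proof -
      have "(\<psi> x)\<^sup>2 \<le> N \<psi>" unfolding N_def using K that by (intro member_le_sum) auto
      then show ?thesis using \<open>N \<psi> = 1\<close> by (simp add: abs_square_le_1)
    qed
    moreover have "N (\<lambda>x. if x \<in> K then \<psi> x else 0) = N \<psi>" unfolding N_def by (intro sum.cong) auto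
    ultimately show ?thesis using that by (auto simp: C_def P_def abs_le_iff)
  qed
  obtain x0 where x0: "x0 \<in> K" using K by auto
  have "N (indicator {x0}) = 1"
    using sum_indicator_singleton_mult[OF K(1) x0, of "indicator {x0}"]
    by (simp add: N_def power2_eq_square del: sum_indicator_mult sum_mult_indicator)
  then have "C \<noteq> {}" using N_in by blast
  then obtain \<phi> where \<phi>: "\<phi> \<in> C" "\<And>\<psi>. \<psi> \<in> C \<Longrightarrow> Q \<phi> \<le> Q \<psi>"
    using continuous_attains_inf[OF \<open>compact C\<close>] continuous_on_subset[OF contQ] by (metis subset_UNIV)
  define lam where "lam = Q \<phi>"
  have N1: "N \<phi> = 1" using \<phi> by (simp add: C_def)
  \<comment> \<open>Both sides are homogeneous of degree two, so the bound on the sphere extends to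
    all vectors.\<close>
  have QN: "Q \<psi> \<ge> lam * N \<psi>" for \<psi>
  proof (cases "N \<psi> = 0")
    case True
    then have "\<psi> x = 0" if "x \<in> K" for x
      using that K by (simp add: N_def sum_nonneg_eq_0_iff)
    then show ?thesis by (simp add: Q_def N_def)
  next
    case False
    have "N \<psi> \<ge> 0" unfolding N_def by (intro sum_nonneg) auto
    with False have pos: "N \<psi> > 0" by simp
    define c where "c = 1 / sqrt (N \<psi>)"
    have c: "c\<^sup>2 = 1 / N \<psi>" using pos by (simp add: c_def power_divide)
    have "N (\<lambda>x. c * \<psi> x) = c\<^sup>2 * N \<psi>"
      by (simp add: N_def power_mult_distrib sum_distrib_left)
    then have "N (\<lambda>x. c * \<psi> x) = 1" using c pos by simp
    from \<phi>(2)[OF N_in[OF this]] have "lam \<le> Q (\<lambda>x. if x \<in> K then c * \<psi> x else 0)"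
      by (simp add: lam_def)
    also have "\<dots> = Q (\<lambda>x. c * \<psi> x)" unfolding Q_def by (intro sum.cong) auto
    also have "\<dots> = c\<^sup>2 * Q \<psi>"
      by (simp add: Q_def sum_distrib_left power2_eq_square ac_simps)
    finally show ?thesis using c pos by (simp add: field_simps)
  qed
  have eig: "(\<Sum>y\<in>K. B x y * \<phi> y) = lam * \<phi> x" if x: "x \<in> K" for x
  proof -
    define e where "e = (indicator {x} :: 'a \<Rightarrow> real)"
    have e_sum: "(\<Sum>y\<in>K. f y * e y) = f x" "(\<Sum>y\<in>K. e y * f y) = f x" for f
      unfolding e_def using sum_indicator_singleton_mult[OF K(1) x, of f] by (simp_all only: mult.commute)
    define L where "L = (\<Sum>y\<in>K. B x y * \<phi> y)"
    \<comment> \<open>Perturbation of the minimiser along one coordinate. The vanishing of the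
      linear term in \<open>s\<close> is the eigenvalue equation at \<open>x\<close>.\<close>
    have Qs: "Q (\<lambda>y. \<phi> y + s * e y) = Q \<phi> + 2 * s * L + s\<^sup>2 * Q e" for s
    proof -
      have "Q (\<lambda>y. \<phi> y + s * e y) = Q \<phi> + s * (\<Sum>u\<in>K. (\<Sum>y\<in>K. B u y * \<phi> y) * e u)
          + s * (\<Sum>u\<in>K. (\<Sum>y\<in>K. B u y * e y) * \<phi> u) + s\<^sup>2 * Q e"
        by (simp add: Q_def algebra_simps sum.distrib sum_distrib_left sum_distrib_right power2_eq_square)
      also have "(\<Sum>u\<in>K. (\<Sum>y\<in>K. B u y * \<phi> y) * e u) = L" unfolding L_def by (rule e_sum)
      also have "(\<Sum>u\<in>K. (\<Sum>y\<in>K. B u y * e y) * \<phi> u) = L"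
        unfolding L_def e_sum using sym x by (intro sum.cong) auto
      finally show ?thesis by simp
    qed
    have Ns: "N (\<lambda>y. \<phi> y + s * e y) = N \<phi> + 2 * s * \<phi> x + s\<^sup>2 * N e" for s
    proof -
      have "N (\<lambda>y. \<phi> y + s * e y) = N \<phi> + 2 * s * (\<Sum>y\<in>K. \<phi> y * e y) + s\<^sup>2 * N e"
        by (simp add: N_def algebra_simps sum.distrib sum_distrib_left power2_eq_square)
      then show ?thesis by (simp add: e_sum)
    qed
    have "2 * s * (L - lam * \<phi> x) + s\<^sup>2 * (Q e - lam * N e) \<ge> 0" for s
      using QN[of "\<lambda>y. \<phi> y + s * e y"] unfolding Qs Ns N1 lam_def[symmetric]
      by (simp add: algebra_simps)
    from quadratic_nonneg_linear_coeff_zero[OF this] show ?thesis by (simp add: L_def)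
  qed
  have "\<exists>x\<in>K. \<phi> x \<noteq> 0"
  proof (rule ccontr)
    assume "\<not> ?thesis"
    then have "N \<phi> = 0" by (simp add: N_def)
    with N1 show False by simp
  qed
  then show ?thesis using eig QN that unfolding Q_def N_def by blast
qed

section \<open>Variational principles for graph Laplacians\<close>

context bounded_degree_graph
begin

lemma lapop_matrix:
  assumes "finite W" "x \<in> W"
  shows "lapop t k W adj \<phi> x = (\<Sum>y\<in>W. ((if x = y then lap_diag t k (deg x) else 0) - (if adj x y then 1 else 0)) * \<phi> y)"
proof -
  have "(\<Sum>y | adj x y. \<phi> y) = (\<Sum>y\<in>W. if adj x y then \<phi> y else 0)"
    using assms(1) by (simp add: nbrs_W[symmetric] sum.inter_filter)
  moreover have "(\<Sum>y\<in>W. (if x = y then lap_diag t k (deg x) else 0) * \<phi> y) =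
      (\<Sum>y\<in>W. if x = y then lap_diag t k (deg x) * \<phi> y else 0)"
    by (intro sum.cong) auto
  moreover have "(\<Sum>y\<in>W. (if adj x y then 1 else 0) * \<phi> y) = (\<Sum>y\<in>W. if adj x y then \<phi> y else 0)"
    by (intro sum.cong) auto
  ultimately show ?thesis
    using assms by (simp add: lapop_altdef left_diff_distrib sum_subtractf)
qed

lemma lapop_min_eigenvector:
  assumes W: "finite W" "W \<noteq> {}"
  obtains lam where "is_eigenvalue t k W adj lam"
    "\<And>\<psi>. (\<Sum>x\<in>W. lapop t k W adj \<psi> x * \<psi> x) \<ge> lam * (\<Sum>x\<in>W. (\<psi> x)\<^sup>2)"
proof -
  define B where "B x y = (if x = y then lap_diag t k (deg x) else 0) - (if adj x y then 1 else 0)" for x y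
  have sym: "B x y = B y x" for x y using adj_sym by (auto simp: B_def)
  obtain lam \<phi> where \<phi>: "\<exists>x\<in>W. \<phi> x \<noteq> 0" "\<And>x. x \<in> W \<Longrightarrow> (\<Sum>y\<in>W. B x y * \<phi> y) = lam * \<phi> x"
    "\<And>\<psi>. (\<Sum>x\<in>W. \<Sum>y\<in>W. B x y * \<psi> y * \<psi> x) \<ge> lam * (\<Sum>x\<in>W. (\<psi> x)\<^sup>2)"
    by (rule symmetric_form_min_eigenvector[where B = B, OF W sym]) (rule that)
  have lap: "lapop t k W adj \<psi> x = (\<Sum>y\<in>W. B x y * \<psi> y)" if "x \<in> W" for \<psi> x
    using lapop_matrix[OF W(1) that] by (simp add: B_def)
  show ?thesis
  proof
    show "is_eigenvalue t k W adj lam"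
      using \<phi>(1,2) lap unfolding is_eigenvalue_def by auto
    show "(\<Sum>x\<in>W. lapop t k W adj \<psi> x * \<psi> x) \<ge> lam * (\<Sum>x\<in>W. (\<psi> x)\<^sup>2)" for \<psi>
      using \<phi>(3)[of \<psi>] by (simp add: lap sum_distrib_right)
  qed
qed

text \<open>The minimum principle for the negated matrix. It serves the Neumann Laplacian, whose
  lowest eigenvalue 0 says nothing about the non-zero ones.\<close>

lemma lapop_max_eigenvector:
  assumes W: "finite W" "W \<noteq> {}"
  obtains lam where "is_eigenvalue t k W adj lam"
    "\<And>\<psi>. (\<Sum>x\<in>W. lapop t k W adj \<psi> x * \<psi> x) \<le> lam * (\<Sum>x\<in>W. (\<psi> x)\<^sup>2)"
proof -
  define B where "B x y = (if adj x y then 1 else 0) - (if x = y then lap_diag t k (deg x) else 0)" for x y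
  have sym: "B x y = B y x" for x y using adj_sym by (auto simp: B_def)
  obtain lam \<phi> where \<phi>: "\<exists>x\<in>W. \<phi> x \<noteq> 0" "\<And>x. x \<in> W \<Longrightarrow> (\<Sum>y\<in>W. B x y * \<phi> y) = lam * \<phi> x"
    "\<And>\<psi>. (\<Sum>x\<in>W. \<Sum>y\<in>W. B x y * \<psi> y * \<psi> x) \<ge> lam * (\<Sum>x\<in>W. (\<psi> x)\<^sup>2)"
    by (rule symmetric_form_min_eigenvector[where B = B, OF W sym]) (rule that)
  have lap: "lapop t k W adj \<psi> x = - (\<Sum>y\<in>W. B x y * \<psi> y)" if "x \<in> W" for \<psi> x
    unfolding lapop_matrix[OF W(1) that] B_def sum_negf[symmetric] by (intro sum.cong) (auto simp: algebra_simps)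
  show ?thesis
  proof
    show "is_eigenvalue t k W adj (- lam)"
      using \<phi>(1,2) lap unfolding is_eigenvalue_def by auto
    show "(\<Sum>x\<in>W. lapop t k W adj \<psi> x * \<psi> x) \<le> - lam * (\<Sum>x\<in>W. (\<psi> x)\<^sup>2)" for \<psi>
      using \<phi>(3)[of \<psi>] by (simp add: lap sum_distrib_right sum_negf)
  qed
qed

lemma eigenvalue_nonneg:
  assumes W: "finite W" and ev: "is_eigenvalue t k W adj lam"
  shows "lam \<ge> 0"
proof -
  obtain \<phi> x where \<phi>: "x \<in> W" "\<phi> x \<noteq> 0" "\<And>x. x \<in> W \<Longrightarrow> lapop t k W adj \<phi> x = lam * \<phi> x"
    using ev unfolding is_eigenvalue_def by blast
  define \<psi> where "\<psi> y = (if y \<in> W then \<phi> y else 0)" for y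
  have "lapop t k W adj \<psi> y = lapop t k W adj \<phi> y" if "y \<in> W" for y
    unfolding lapop_matrix[OF W that] by (intro sum.cong) (auto simp: \<psi>_def)
  then have "(\<Sum>y\<in>W. lapop t k W adj \<psi> y * \<psi> y) = lam * (\<Sum>y\<in>W. (\<psi> y)\<^sup>2)"
    by (simp add: sum_distrib_left \<phi>(3) \<psi>_def power2_eq_square mult.assoc)
  moreover have "0 \<le> (\<Sum>y\<in>W. lapop t k W adj \<psi> y * \<psi> y)"
    by (rule lapop_form_bounds(1)[OF W]) (auto simp: \<psi>_def)
  moreover have "(\<Sum>y\<in>W. (\<psi> y)\<^sup>2) > 0"
    using \<phi> W by (intro sum_pos2[of _ x]) (auto simp: \<psi>_def)
  ultimately show ?thesis by (simp add: zero_le_mult_iff)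
qed

text \<open>The double sum meets every edge in both orders, whence the factor 2.\<close>

lemma neumann_form:
  assumes W: "finite W"
  shows "2 * (\<Sum>x\<in>W. lapop LapN k W adj \<phi> x * \<phi> x) = (\<Sum>x\<in>W. \<Sum>y\<in>W. if adj x y then (\<phi> x - \<phi> y)\<^sup>2 else 0)"
proof -
  define I where "I = (\<Sum>x\<in>W. \<Sum>y\<in>W. if adj x y then \<phi> x * \<phi> y else 0)"
  define D where "D = (\<Sum>x\<in>W. \<Sum>y\<in>W. if adj x y then (\<phi> x)\<^sup>2 else 0)"
  have nb: "(\<Sum>y\<in>W. if adj x y then f y else 0) = (\<Sum>y | adj x y. f y)" for x and f :: "'a \<Rightarrow> real"
    using W by (simp add: nbrs_W[symmetric] sum.inter_filter)
  have swap: "(\<Sum>x\<in>W. \<Sum>y\<in>W. if adj x y then (\<phi> y)\<^sup>2 else 0) = D"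
    unfolding D_def by (subst sum.swap) (auto intro!: sum.cong dest: adj_sym)
  have "(\<Sum>x\<in>W. \<Sum>y\<in>W. if adj x y then (\<phi> x - \<phi> y)\<^sup>2 else 0) =
    (\<Sum>x\<in>W. \<Sum>y\<in>W. (if adj x y then (\<phi> x)\<^sup>2 else 0) + (if adj x y then (\<phi> y)\<^sup>2 else 0)
      - 2 * (if adj x y then \<phi> x * \<phi> y else 0))"
    by (intro sum.cong) (auto simp: power2_diff)
  also have "\<dots> = 2 * D - 2 * I"
    by (simp add: sum.distrib sum_subtractf swap flip: D_def I_def sum_distrib_left)
  also have "D - I = (\<Sum>x\<in>W. lapop LapN k W adj \<phi> x * \<phi> x)"
  proof -
    have "lapop LapN k W adj \<phi> x * \<phi> x = (\<Sum>y | adj x y. (\<phi> x)\<^sup>2) - (\<Sum>y | adj x y. \<phi> x * \<phi> y)"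
      if "x \<in> W" for x
    proof -
      have "lapop LapN k W adj \<phi> x * \<phi> x = deg x * (\<phi> x)\<^sup>2 - \<phi> x * (\<Sum>y | adj x y. \<phi> y)"
        using that by (simp add: lapop_altdef lap_diag_def algebra_simps power2_eq_square)
      then show ?thesis by (simp add: sum_distrib_left)
    qed
    then show ?thesis
      unfolding D_def I_def sum_subtractf[symmetric] nb by simp
  qed
  then have "2 * D - 2 * I = 2 * (\<Sum>x\<in>W. lapop LapN k W adj \<phi> x * \<phi> x)" by simp
  finally show ?thesis by simp
qed

end

text \<open>A repetition or a forward chord would give a shorter chain. For symmetric irreflexive
  \<open>R\<close> this makes a geodesic an induced path.\<close>

lemma shortest_chain:
  assumes "(x, y) \<in> R\<^sup>*"
  obtains n f where "f 0 = x" "f n = y" "\<And>i. i < n \<Longrightarrow> (f i, f (Suc i)) \<in> R"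
    "\<And>i j. i < j \<Longrightarrow> j \<le> n \<Longrightarrow> f i \<noteq> f j"
    "\<And>i j. i < j \<Longrightarrow> j \<le> n \<Longrightarrow> (f i, f j) \<in> R \<Longrightarrow> j = Suc i"
proof -
  define n where "n = (LEAST n. (x, y) \<in> R ^^ n)"
  have "\<exists>n. (x, y) \<in> R ^^ n" using assms by (simp add: rtrancl_power)
  then have "(x, y) \<in> R ^^ n" unfolding n_def by (rule LeastI_ex)
  then obtain f where f: "f 0 = x" "f n = y" "\<And>i. i < n \<Longrightarrow> (f i, f (Suc i)) \<in> R"
    by (auto simp: relpow_fun_conv)
  have least: "n \<le> m" if "(x, y) \<in> R ^^ m" for m
    unfolding n_def using that by (rule Least_le)
  have init: "(x, f i) \<in> R ^^ i" if "i \<le> n" for i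
    unfolding relpow_fun_conv using f that by (intro exI[of _ f]) auto
  have final: "(f j, y) \<in> R ^^ (n - j)" if "j \<le> n" for j
    unfolding relpow_fun_conv using f that by (intro exI[of _ "\<lambda>i. f (i + j)"]) auto
  show ?thesis
  proof (rule that[OF f])
    fix i j assume ij: "i < j" "j \<le> n"
    show "f i \<noteq> f j"
    proof
      assume "f i = f j"
      then have "(x, y) \<in> R ^^ (i + (n - j))"
        using init[of i] final[of j] ij unfolding relpow_add by (auto intro: relcompI)
      with least[of "i + (n - j)"] ij show False by simp
    qed
    assume "(f i, f j) \<in> R"
    then have "(x, f j) \<in> R ^^ Suc i" using init[of i] ij by auto
    then have "(x, y) \<in> R ^^ (Suc i + (n - j))"
      using final[of j] ij unfolding relpow_add by (auto intro: relcompI)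
    from least[OF this] ij show "j = Suc i" by simp
  qed
qed

section \<open>Non-zero Neumann eigenvalues of finite connected graphs\<close>

context bounded_degree_graph
begin

text \<open>A discrete Poincare inequality. The eigenvector is orthogonal to the constants, so
  somewhere it vanishes or has the sign opposite to its extreme value phi(x0). Along a path of m <=
  n steps between these points, Cauchy-Schwarz bounds phi(x0)^2 by m times the Dirichlet sum 2 lam
  ||phi||^2 <= 2 lam n phi(x0)^2.\<close>

lemma neumann_eigenvalue_ge:
  assumes W: "finite W" and conn: "\<And>x y. x \<in> W \<Longrightarrow> y \<in> W \<Longrightarrow> (x, y) \<in> {(u, v). adj u v}\<^sup>*"
    and ev: "is_eigenvalue LapN k W adj lam" "lam \<noteq> 0"
  shows "1 \<le> 2 * (real (card W))\<^sup>2 * lam"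
proof -
  obtain \<phi>0 where \<phi>0: "\<exists>x\<in>W. \<phi>0 x \<noteq> 0" "\<And>x. x \<in> W \<Longrightarrow> lapop LapN k W adj \<phi>0 x = lam * \<phi>0 x"
    using ev(1) unfolding is_eigenvalue_def by blast
  define \<phi> where "\<phi> y = (if y \<in> W then \<phi>0 y else 0)" for y
  have \<phi>: "lapop LapN k W adj \<phi> y = lam * \<phi> y" for y
  proof (cases "y \<in> W")
    case True
    have "lapop LapN k W adj \<phi> y = lapop LapN k W adj \<phi>0 y"
      unfolding lapop_matrix[OF W True] by (intro sum.cong) (auto simp: \<phi>_def)
    then show ?thesis using \<phi>0(2)[OF True] True by (simp add: \<phi>_def)
  qed (simp add: lapop_altdef \<phi>_def)
  define n where "n = real (card W)"
  have sum0: "(\<Sum>x\<in>W. \<phi> x) = 0"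
  proof -
    have one: "lapop LapN k W adj (indicator W) x = 0" if "x \<in> W" for x
    proof -
      have "(\<Sum>y | adj x y. indicator W y :: real) = (\<Sum>y | adj x y. 1)"
        by (intro sum.cong) (auto simp: indicator_def intro: adj_in[OF adj_sym])
      then show ?thesis using that by (simp add: lapop_altdef lap_diag_def)
    qed
    have "lam * (\<Sum>x\<in>W. \<phi> x) = (\<Sum>x\<in>W. lapop LapN k W adj \<phi> x * indicator W x)"
      by (simp add: \<phi> sum_distrib_left)
    also have "\<dots> = (\<Sum>x\<in>W. \<phi> x * lapop LapN k W adj (indicator W) x)"
      by (rule lapop_inner_sym[OF W]) (auto simp: \<phi>_def)
    also have "\<dots> = 0" using one by simp
    finally show ?thesis using ev(2) by simp
  qed
  have Wne: "W \<noteq> {}" using \<phi>0(1) by auto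
  obtain x0 where x0: "x0 \<in> W" "\<And>y. y \<in> W \<Longrightarrow> \<bar>\<phi> y\<bar> \<le> \<bar>\<phi> x0\<bar>"
  proof -
    have "Max ((\<lambda>y. \<bar>\<phi> y\<bar>) ` W) \<in> (\<lambda>y. \<bar>\<phi> y\<bar>) ` W" using W Wne by (intro Max_in) auto
    then obtain x0 where "x0 \<in> W" "\<bar>\<phi> x0\<bar> = Max ((\<lambda>y. \<bar>\<phi> y\<bar>) ` W)" by auto
    then show ?thesis using W that by simp
  qed
  have x0nz: "\<phi> x0 \<noteq> 0"
  proof
    assume "\<phi> x0 = 0"
    then have "\<phi>0 x = 0" if "x \<in> W" for x using x0(2)[OF that] that by (simp add: \<phi>_def)
    then show False using \<phi>0(1) by auto
  qed
  obtain y0 where y0: "y0 \<in> W" "\<phi> x0 * \<phi> y0 \<le> 0"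
  proof -
    have "\<exists>y\<in>W. \<phi> x0 * \<phi> y \<le> 0"
    proof (rule ccontr)
      assume "\<not> ?thesis"
      then have "(\<Sum>y\<in>W. \<phi> x0 * \<phi> y) > 0" using W Wne by (intro sum_pos) auto
      then show False using sum0 by (simp flip: sum_distrib_left)
    qed
    then show ?thesis using that by blast
  qed
  have "(\<phi> x0)\<^sup>2 \<le> (\<phi> x0 - \<phi> y0)\<^sup>2"
    using y0(2) zero_le_power2[of "\<phi> y0"] unfolding power2_diff by linarith
  obtain m f where f: "f 0 = x0" "f m = y0" "\<And>i. i < m \<Longrightarrow> (f i, f (Suc i)) \<in> {(u, v). adj u v}"
    "\<And>i j. i < j \<Longrightarrow> j \<le> m \<Longrightarrow> f i \<noteq> f j"
    "\<And>i j. i < j \<Longrightarrow> j \<le> m \<Longrightarrow> (f i, f j) \<in> {(u, v). adj u v} \<Longrightarrow> j = Suc i"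
    by (rule shortest_chain[OF conn[OF x0(1) y0(1)]]) (rule that)
  have fW: "f i \<in> W" if "i \<le> m" for i
  proof (cases "i = m")
    case False
    then have "adj (f i) (f (Suc i))" using f(3)[of i] that by simp
    then show ?thesis by (rule adj_in)
  qed (use f(2) y0(1) in simp)
  have inj: "inj_on f {..m}"
    by (rule linorder_inj_onI) (use f(4) in auto)
  have mn: "real m \<le> n"
  proof -
    have "card (f ` {..m}) \<le> card W" using fW W by (intro card_mono) auto
    then show ?thesis using card_image[OF inj] by (simp add: n_def)
  qed
  define E where "E = (\<Sum>x\<in>W. \<Sum>y\<in>W. if adj x y then (\<phi> x - \<phi> y)\<^sup>2 else 0)"
  have tel: "\<phi> x0 - \<phi> y0 = (\<Sum>i<m. 1 * (\<phi> (f i) - \<phi> (f (Suc i))))"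
    using sum_lessThan_telescope'[of "\<lambda>i. \<phi> (f i)" m] f by simp
  have "(\<phi> x0 - \<phi> y0)\<^sup>2 \<le> (\<Sum>i<m. 1\<^sup>2) * (\<Sum>i<m. (\<phi> (f i) - \<phi> (f (Suc i)))\<^sup>2)"
    unfolding tel by (rule Cauchy_Schwarz_ineq_sum)
  also have "(\<Sum>i<m. (\<phi> (f i) - \<phi> (f (Suc i)))\<^sup>2) \<le> E"
  proof -
    define P where "P = (\<lambda>i. (f i, f (Suc i))) ` {..<m}"
    \<comment> \<open>The steps of an injective path are distinct ordered pairs, hence distinct
      terms of the double sum \<open>E\<close>.\<close>
    have "inj_on (\<lambda>i. (f i, f (Suc i))) {..<m}"
      using inj by (auto simp: inj_on_def)
    then have "(\<Sum>i<m. (\<phi> (f i) - \<phi> (f (Suc i)))\<^sup>2) = (\<Sum>(x, y)\<in>P. if adj x y then (\<phi> x - \<phi> y)\<^sup>2 else 0)"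
      unfolding P_def using f(3) by (subst sum.reindex) (auto intro!: sum.cong)
    also have "\<dots> \<le> (\<Sum>(x, y)\<in>W \<times> W. if adj x y then (\<phi> x - \<phi> y)\<^sup>2 else 0)"
      using W fW by (intro sum_mono2) (auto simp: P_def)
    also have "\<dots> = E" by (simp add: E_def sum.cartesian_product)
    finally show ?thesis .
  qed
  also have "E = 2 * (\<Sum>x\<in>W. lapop LapN k W adj \<phi> x * \<phi> x)"
    unfolding E_def by (rule neumann_form[OF W, symmetric])
  also have "\<dots> = 2 * lam * (\<Sum>x\<in>W. (\<phi> x)\<^sup>2)"
    by (simp add: \<phi> sum_distrib_left power2_eq_square mult.assoc)
  finally have A: "(\<phi> x0 - \<phi> y0)\<^sup>2 \<le> real m * (2 * lam * (\<Sum>x\<in>W. (\<phi> x)\<^sup>2))"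
    by (simp add: mult_left_mono)
  have lam: "lam \<ge> 0" using eigenvalue_nonneg[OF W ev(1)] .
  have B: "(\<Sum>x\<in>W. (\<phi> x)\<^sup>2) \<le> n * (\<phi> x0)\<^sup>2"
    unfolding n_def using x0(2) by (intro sum_bounded_above) (simp add: abs_le_square_iff)
  have "(\<phi> x0)\<^sup>2 \<le> real m * (2 * lam * (\<Sum>x\<in>W. (\<phi> x)\<^sup>2))"
    using A \<open>(\<phi> x0)\<^sup>2 \<le> (\<phi> x0 - \<phi> y0)\<^sup>2\<close> by linarith
  also have "\<dots> \<le> n * (2 * lam * (n * (\<phi> x0)\<^sup>2))"
    using mn lam B by (intro mult_mono) (auto intro!: sum_nonneg mult_nonneg_nonneg)
  finally have "1 * (\<phi> x0)\<^sup>2 \<le> (2 * n\<^sup>2 * lam) * (\<phi> x0)\<^sup>2"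
    by (simp add: power2_eq_square ac_simps)
  then show ?thesis
    using x0nz unfolding n_def by (subst (asm) mult_le_cancel_right_pos) auto
qed

text \<open>Ensures that \<open>lowest_nonzero_eig\<close> is the infimum of a non-empty set. If the
  largest eigenvalue were 0, the Dirichlet form would vanish identically, yet the indicator of
  \<open>x\<close> jumps across the edge to \<open>y\<close>.\<close>

lemma neumann_nonzero_eigenvalue_exists:
  assumes W: "finite W" and xy: "adj x y" "x \<noteq> y"
  shows "\<exists>lam. lam \<noteq> 0 \<and> is_eigenvalue LapN k W adj lam"
proof -
  have "x \<in> W" "W \<noteq> {}" using xy adj_in by auto
  obtain lam where lam: "is_eigenvalue LapN k W adj lam"
    "\<And>\<psi>. (\<Sum>x\<in>W. lapop LapN k W adj \<psi> x * \<psi> x) \<le> lam * (\<Sum>x\<in>W. (\<psi> x)\<^sup>2)"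
    by (rule lapop_max_eigenvector[OF W \<open>W \<noteq> {}\<close>]) (rule that)
  have "lam \<noteq> 0"
  proof
    assume "lam = 0"
    then have "(\<Sum>u\<in>W. \<Sum>v\<in>W. if adj u v then (indicator {x} u - indicator {x} v)\<^sup>2 else (0::real)) \<le> 0"
      using lam(2)[of "indicator {x}"] neumann_form[OF W, of "indicator {x}"] by simp
    moreover have "(\<Sum>u\<in>W. \<Sum>v\<in>W. if adj u v then (indicator {x} u - indicator {x} v)\<^sup>2 else (0::real)) \<ge> 0"
      by (intro sum_nonneg) auto
    ultimately have z: "(\<Sum>u\<in>W. \<Sum>v\<in>W. if adj u v then (indicator {x} u - indicator {x} v)\<^sup>2 else (0::real)) = 0"
      by simp
    have inner: "(\<Sum>v\<in>W. if adj x v then (indicator {x} x - indicator {x} v)\<^sup>2 else (0::real)) = 0"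
      using z W \<open>x \<in> W\<close> by (subst (asm) sum_nonneg_eq_0_iff) (auto intro!: sum_nonneg)
    then have *: "(if adj x v then (indicator {x} x - indicator {x} v)\<^sup>2 else (0::real)) = 0" if "v \<in> W" for v
      using W that by (subst (asm) sum_nonneg_eq_0_iff) auto
    show False using *[of y] xy adj_in[OF adj_sym[OF xy(1)]] by simp
  qed
  with lam(1) show ?thesis by blast
qed

end

section \<open>Comparison of eigenvalues and conclusion\<close>

lemma lap_diag_antimono: "t \<noteq> LapN \<Longrightarrow> d \<le> d' \<Longrightarrow> lap_diag t k d' \<le> lap_diag t k d"
  by (cases t) (auto simp: lap_diag_def)

section \<open>The Neumann eigenvalue of a path\<close>

lemma two_minus_two_cos_le: "2 - 2 * cos x \<le> (x::real)\<^sup>2"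
proof -
  have "2 - 2 * cos x = 4 * (sin (x / 2))\<^sup>2"
    using cos_double_sin[of "x / 2"] by simp
  also have "\<dots> \<le> 4 * (x / 2)\<^sup>2"
    using abs_sin_x_le_abs_x[of "x / 2"] by (simp only: abs_le_square_iff)
  finally show ?thesis by (simp add: power_divide)
qed

text \<open>The eigenvector is the Neumann mode \<open>j \<mapsto> cos (\<theta> (j + 1/2))\<close>: reflecting it at \<open>-1/2\<close> and
  \<open>L - 1/2\<close> makes the boundary terms vanish.\<close>
lemma path_neumann_sum:
  fixes L i :: nat
  assumes i: "i < L"
  defines "\<theta> \<equiv> pi / real L"
  defines "c \<equiv> \<lambda>j::nat. cos (\<theta> * (real j + 1 / 2))"
  defines "N \<equiv> {j. j < L \<and> (j = Suc i \<or> i = Suc j)}"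
  shows "real (card N) * c i - (\<Sum>j\<in>N. c j) = (2 - 2 * cos \<theta>) * c i"
proof -
  have N: "N = (if Suc i < L then {Suc i} else {}) \<union> (if i > 0 then {i - 1} else {})"
    using i by (auto simp: N_def)
  have "real (card N) * c i - (\<Sum>j\<in>N. c j) = (\<Sum>j\<in>N. c i - c j)"
    by (simp add: sum_subtractf)
  also have "\<dots> = (if Suc i < L then c i - c (Suc i) else 0) + (if i > 0 then c i - c (i - 1) else 0)"
    unfolding N by (subst sum.union_disjoint) auto
  also have "(if Suc i < L then c i - c (Suc i) else 0) = c i - cos (\<theta> * (real i + 1 / 2) + \<theta>)"
  proof (cases "Suc i < L")
    case True
    then show ?thesis by (simp add: c_def algebra_simps)
  next
    case False
    with i have L: "real L = real i + 1" by simp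
    \<comment> \<open>At the right end the two angles lie symmetrically about pi, so their cosines
      agree and the missing neighbour costs nothing.\<close>
    have "\<theta> * (real i + 1 / 2) + \<theta> = pi + \<theta> / 2" "\<theta> * (real i + 1 / 2) = pi - \<theta> / 2"
    proof -
      have "\<theta> * (real i + 1) = pi" unfolding \<theta>_def L by simp
      then show "\<theta> * (real i + 1 / 2) + \<theta> = pi + \<theta> / 2" "\<theta> * (real i + 1 / 2) = pi - \<theta> / 2"
        unfolding distrib_left by linarith+
    qed
    then show ?thesis using False by (simp add: c_def cos_diff cos_add)
  qed
  also have "(if i > 0 then c i - c (i - 1) else 0) = c i - cos (\<theta> * (real i + 1 / 2) - \<theta>)"
  proof (cases "i > 0")
    case True
    then show ?thesis by (simp add: c_def algebra_simps of_nat_diff)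
  next
    case False
    have "cos (\<theta> / 2 - \<theta>) = cos (\<theta> / 2)" using cos_minus[of "\<theta> / 2"] by (simp add: field_simps del: cos_minus)
    with False show ?thesis by (simp add: c_def)
  qed
  moreover have "cos (\<theta> * (real i + 1 / 2)) = c i" by (simp add: c_def)
  ultimately show ?thesis unfolding cos_add cos_diff by (simp add: algebra_simps)
qed

section \<open>Comparing a subgraph with the induced graph; choice of the cluster\<close>

context cayley_graph
begin

text \<open>\<open>lapop\<close> itself discards neighbours outside \<open>K\<close>, whereas
  \<open>bounded_degree_graph\<close> wants an adjacency confined to \<open>K\<close>. This mediates
  between the two encodings.\<close>

lemma is_eigenvalue_induced:
  "is_eigenvalue t (card S) K (\<lambda>x y. x \<in> K \<and> y \<in> K \<and> cay G S x y) lam \<longleftrightarrow>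
   is_eigenvalue t (card S) K (cay G S) lam"
proof -
  have "lapop t (card S) K (\<lambda>x y. x \<in> K \<and> y \<in> K \<and> cay G S x y) \<phi> x = lapop t (card S) K (cay G S) \<phi> x"
    if "x \<in> K" for \<phi> x
  proof -
    have "{y \<in> K. x \<in> K \<and> y \<in> K \<and> cay G S x y} = {y \<in> K. cay G S x y}" using that by auto
    then show ?thesis using that by (cases t) (simp_all add: lapop_def gdeg_def adjop_def)
  qed
  then show ?thesis unfolding is_eigenvalue_def by auto
qed

lemma subgraph_adj:
  assumes "subgraph G S H"
  shows "sg_adj H x y \<Longrightarrow> sg_adj H y x" and "sg_adj H x y \<Longrightarrow> x \<in> fst H" and "sg_adj H x y \<Longrightarrow> cay G S x y"
proof -
  show "sg_adj H x y \<Longrightarrow> sg_adj H y x" by (simp add: sg_adj_def insert_commute)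
  show "sg_adj H x y \<Longrightarrow> x \<in> fst H" using assms unfolding subgraph_def sg_adj_def by blast
  assume "sg_adj H x y"
  then have "{x, y} \<in> cay_edges G S" using assms unfolding subgraph_def sg_adj_def by blast
  then obtain u v where "{x, y} = {u, v}" "cay G S u v" unfolding cay_edges_def by blast
  then show "cay G S x y" using cay_sym by (auto simp: doubleton_eq_iff)
qed

lemma subgraph_bounded:
  assumes "subgraph G S H"
  shows "bounded_degree_graph (fst H) (sg_adj H) (card S)"
  by (rule subgraph_bounded_degree) (use subgraph_adj[OF assms] in blast)+

lemma connected_has_nbr:
  assumes H: "subgraph G S H" "connected_graph H" "finite (fst H)" and card: "card (fst H) \<ge> 2" and x: "x \<in> fst H"
  shows "\<exists>y\<in>fst H. sg_adj H x y"
proof -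
  have "fst H \<noteq> {x}" using card by auto
  then obtain z where z: "z \<in> fst H" "z \<noteq> x" using x by blast
  then have "(x, z) \<in> {(u, v). sg_adj H u v}\<^sup>*" using H(2) x unfolding connected_graph_def by blast
  then obtain y where "sg_adj H x y" using z(2) by (auto elim: converse_rtranclE)
  then show ?thesis using subgraph_adj[OF H(1)] by blast
qed

text \<open>Maximum principle. For A and D the diagonal is at least k = |S|, so at a maximum M of
  |phi| the eigenvalue equation gives k M <= sum of |phi| over the neighbours <= k M. Equality
  forces all Cayley neighbours to lie in \<open>W\<close> and to be maxima too, so the finite
  \<open>W\<close> would exhaust the group.\<close>

lemma zero_not_eigenvalue:
  assumes inf: "infinite (carrier G)" and t: "t \<noteq> LapN" and W: "finite W" "W \<subseteq> carrier G"
    and g: "bounded_degree_graph W adj (card S)" and sub: "\<And>x y. adj x y \<Longrightarrow> cay G S x y"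
  shows "\<not> is_eigenvalue t (card S) W adj 0"
proof
  interpret g: bounded_degree_graph W adj "card S" by fact
  assume "is_eigenvalue t (card S) W adj 0"
  then obtain \<phi> x1 where \<phi>: "x1 \<in> W" "\<phi> x1 \<noteq> 0" "\<And>x. x \<in> W \<Longrightarrow> lapop t (card S) W adj \<phi> x = 0"
    unfolding is_eigenvalue_def by auto
  define M where "M = Max ((\<lambda>y. \<bar>\<phi> y\<bar>) ` W)"
  have le_M: "\<bar>\<phi> y\<bar> \<le> M" if "y \<in> W" for y unfolding M_def using W that by simp
  have M: "M > 0" using le_M[OF \<phi>(1)] \<phi>(2) by linarith
  have "M \<in> (\<lambda>y. \<bar>\<phi> y\<bar>) ` W" unfolding M_def using W \<phi>(1) by (intro Max_in) auto
  then obtain x0 where x0: "x0 \<in> W" "\<bar>\<phi> x0\<bar> = M" by auto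
  have "{x \<in> W. \<bar>\<phi> x\<bar> = M} = carrier G"
  proof (rule cay_closed_eq_carrier)
    show "x0 \<in> {x \<in> W. \<bar>\<phi> x\<bar> = M}" using x0 by simp
    fix x y assume "x \<in> {x \<in> W. \<bar>\<phi> x\<bar> = M}" and xy: "cay G S x y"
    then have x: "x \<in> W" "\<bar>\<phi> x\<bar> = M" by auto
    \<comment> \<open>Absent neighbours count as 0, so that equality also excludes missing
      edges.\<close>
    define h where "h z = (if adj x z then \<bar>\<phi> z\<bar> else 0)" for z
    have h_le: "h z \<le> M" for z
      using le_M[of z] g.adj_in[OF g.adj_sym[of x z]] M by (auto simp: h_def)
    have "real (card S) \<le> lap_diag t (card S) (g.deg x)"
      using t g.card_nbrs[of x] by (cases t) (auto simp: lap_diag_def)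
    then have "real (card S) * M \<le> lap_diag t (card S) (g.deg x) * M"
      using M by (intro mult_right_mono) auto
    also have "\<dots> = \<bar>lap_diag t (card S) (g.deg x) * \<phi> x\<bar>"
      using x g.lap_diag_bounds(1)[of x t] by (simp add: abs_mult)
    also have "lap_diag t (card S) (g.deg x) * \<phi> x = (\<Sum>z | adj x z. \<phi> z)"
      using \<phi>(3)[OF x(1)] x(1) by (simp add: g.lapop_altdef)
    also have "\<bar>\<dots>\<bar> \<le> (\<Sum>z | adj x z. \<bar>\<phi> z\<bar>)" by (rule sum_abs)
    also have "\<dots> = (\<Sum>z | cay G S x z. h z)"
    proof -
      have "{z. adj x z} = {z \<in> {z. cay G S x z}. adj x z}" using sub by auto
      then show ?thesis
        unfolding h_def using sum.inter_filter[OF finite_cay_nbrs[of x], of "\<lambda>z. \<bar>\<phi> z\<bar>" "adj x"] by simp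
    qed
    finally have "(\<Sum>z | cay G S x z. M - h z) \<le> 0"
      using x W card_cay_nbrs[of x] by (auto simp: sum_subtractf)
    moreover have "(\<Sum>z | cay G S x z. M - h z) \<ge> 0" by (intro sum_nonneg) (simp add: h_le)
    ultimately have "(\<Sum>z | cay G S x z. M - h z) = 0" by simp
    then have "h y = M"
      using xy h_le finite_cay_nbrs by (subst (asm) sum_nonneg_eq_0_iff) auto
    then show "y \<in> {x \<in> W. \<bar>\<phi> x\<bar> = M}"
      using M g.adj_in[OF g.adj_sym[of x y]] by (auto simp: h_def split: if_splits)
  qed (use W in auto)
  moreover have "finite {x \<in> W. \<bar>\<phi> x\<bar> = M}" using W by simp
  ultimately show False using inf by simp
qed

text \<open>The test vector is |phi|: for it every added edge contributes a non-positive
  off-diagonal term, and the diagonal of A and D does not grow with the degree.\<close>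

lemma induced_min_eigenvalue_le:
  assumes t: "t \<noteq> LapN" and W: "finite W"
    and g: "bounded_degree_graph W adj (card S)" and sub: "\<And>x y. adj x y \<Longrightarrow> cay G S x y"
    and ev: "is_eigenvalue t (card S) W adj mu"
    and min: "\<And>\<psi>. (\<Sum>x\<in>W. lapop t (card S) W (\<lambda>x y. x \<in> W \<and> y \<in> W \<and> cay G S x y) \<psi> x * \<psi> x) \<ge> lam * (\<Sum>x\<in>W. (\<psi> x)\<^sup>2)"
  shows "lam \<le> mu"
proof -
  interpret g: bounded_degree_graph W adj "card S" by fact
  interpret ind: bounded_degree_graph W "\<lambda>x y. x \<in> W \<and> y \<in> W \<and> cay G S x y" "card S"
    by (rule bounded_degree_induced)
  obtain \<phi> x1 where \<phi>: "x1 \<in> W" "\<phi> x1 \<noteq> 0" "\<And>x. x \<in> W \<Longrightarrow> lapop t (card S) W adj \<phi> x = mu * \<phi> x"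
    using ev unfolding is_eigenvalue_def by auto
  define \<psi> where "\<psi> x = \<bar>\<phi> x\<bar>" for x
  have nbrs: "{y. adj x y} \<subseteq> {y. x \<in> W \<and> y \<in> W \<and> cay G S x y}" for x
    using g.adj_in g.adj_sym sub by blast
  have "lapop t (card S) W (\<lambda>x y. x \<in> W \<and> y \<in> W \<and> cay G S x y) \<psi> x * \<psi> x \<le> lapop t (card S) W adj \<phi> x * \<phi> x"
    if x: "x \<in> W" for x
  proof -
    have d: "lap_diag t (card S) (ind.deg x) \<le> lap_diag t (card S) (g.deg x)"
      by (rule lap_diag_antimono[OF t]) (use card_mono[OF ind.finite_nbrs nbrs] in simp)
    have "(\<Sum>y | adj x y. \<phi> y) * \<phi> x \<le> (\<Sum>y | adj x y. \<psi> y) * \<psi> x"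
    proof -
      have "(\<Sum>y | adj x y. \<phi> y) * \<phi> x \<le> \<bar>(\<Sum>y | adj x y. \<phi> y)\<bar> * \<bar>\<phi> x\<bar>"
        by (metis abs_ge_self abs_mult)
      also have "\<dots> \<le> (\<Sum>y | adj x y. \<psi> y) * \<psi> x"
        unfolding \<psi>_def by (intro mult_right_mono sum_abs) auto
      finally show ?thesis .
    qed
    also have "\<dots> \<le> (\<Sum>y | x \<in> W \<and> y \<in> W \<and> cay G S x y. \<psi> y) * \<psi> x"
      by (intro mult_right_mono sum_mono2 ind.finite_nbrs nbrs) (auto simp: \<psi>_def)
    finally have "(\<Sum>y | adj x y. \<phi> y) * \<phi> x \<le> (\<Sum>y | x \<in> W \<and> y \<in> W \<and> cay G S x y. \<psi> y) * \<psi> x" .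
    moreover have "lap_diag t (card S) (ind.deg x) * \<psi> x * \<psi> x \<le> lap_diag t (card S) (g.deg x) * \<phi> x * \<phi> x"
      using mult_right_mono[OF d, of "(\<phi> x)\<^sup>2"] by (simp add: \<psi>_def power2_eq_square mult.assoc)
    ultimately show ?thesis
      using x unfolding g.lapop_altdef ind.lapop_altdef by (simp add: left_diff_distrib)
  qed
  then have "(\<Sum>x\<in>W. lapop t (card S) W (\<lambda>x y. x \<in> W \<and> y \<in> W \<and> cay G S x y) \<psi> x * \<psi> x)
      \<le> (\<Sum>x\<in>W. lapop t (card S) W adj \<phi> x * \<phi> x)"
    by (intro sum_mono)
  also have "\<dots> = mu * (\<Sum>x\<in>W. (\<phi> x)\<^sup>2)"
    by (simp add: \<phi>(3) sum_distrib_left power2_eq_square mult.assoc)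
  finally have "lam * (\<Sum>x\<in>W. (\<phi> x)\<^sup>2) \<le> mu * (\<Sum>x\<in>W. (\<phi> x)\<^sup>2)"
    using min[of \<psi>] by (simp add: \<psi>_def)
  moreover have "(\<Sum>x\<in>W. (\<phi> x)\<^sup>2) > 0" using \<phi> W by (intro sum_pos2[of _ x1]) auto
  ultimately show ?thesis by simp
qed

lemma induced_eigenvalue_le_lowest:
  assumes inf: "infinite (carrier G)" and t: "t \<noteq> LapN"
    and H: "subgraph G S H" "finite (fst H)" "fst H \<noteq> {}"
  obtains lam where "0 < lam" "lam \<le> lowest_nonzero_eig t (card S) H"
    "is_eigenvalue t (card S) (fst H) (cay G S) lam"
proof -
  interpret ind: bounded_degree_graph "fst H" "\<lambda>x y. x \<in> fst H \<and> y \<in> fst H \<and> cay G S x y" "card S"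
    by (rule bounded_degree_induced)
  interpret g: bounded_degree_graph "fst H" "sg_adj H" "card S"
    by (rule subgraph_bounded[OF H(1)])
  have sub: "fst H \<subseteq> carrier G" using H(1) by (simp add: subgraph_def)
  obtain lam where lam: "is_eigenvalue t (card S) (fst H) (\<lambda>x y. x \<in> fst H \<and> y \<in> fst H \<and> cay G S x y) lam"
    "\<And>\<psi>. (\<Sum>x\<in>fst H. lapop t (card S) (fst H) (\<lambda>x y. x \<in> fst H \<and> y \<in> fst H \<and> cay G S x y) \<psi> x * \<psi> x) \<ge> lam * (\<Sum>x\<in>fst H. (\<psi> x)\<^sup>2)"
    by (rule ind.lapop_min_eigenvector[OF H(2,3)]) (rule that)
  \<comment> \<open>This eigenvalue only shows that the infimum in \<open>lowest_nonzero_eig\<close>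
    is over a non-empty set.\<close>
  obtain mu where mu: "is_eigenvalue t (card S) (fst H) (sg_adj H) mu"
    by (rule g.lapop_min_eigenvector[OF H(2,3)])
  have "lam \<noteq> 0"
    using lam(1) zero_not_eigenvalue[OF inf t H(2) sub bounded_degree_induced] by auto
  moreover have "lam \<ge> 0" using ind.eigenvalue_nonneg[OF H(2) lam(1)] .
  moreover have "mu \<noteq> 0"
    using mu zero_not_eigenvalue[OF inf t H(2) sub subgraph_bounded[OF H(1)] subgraph_adj(3)[OF H(1)]] by auto
  then have "lam \<le> lowest_nonzero_eig t (card S) H"
    unfolding lowest_nonzero_eig_def
    using mu induced_min_eigenvalue_le[OF t H(2) subgraph_bounded[OF H(1)] subgraph_adj(3)[OF H(1)] _ lam(2)]
    by (intro cInf_greatest) auto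
  ultimately show ?thesis
    using that[of lam] lam(1) by (simp add: is_eigenvalue_induced)
qed

lemma lowest_neumann_ge:
  assumes H: "subgraph G S H" "finite (fst H)" "connected_graph H" "card (fst H) \<ge> 2"
  shows "1 / (2 * (real (card (fst H)))\<^sup>2) \<le> lowest_nonzero_eig LapN (card S) H"
proof -
  interpret g: bounded_degree_graph "fst H" "sg_adj H" "card S"
    by (rule subgraph_bounded[OF H(1)])
  have conn: "(x, y) \<in> {(u, v). sg_adj H u v}\<^sup>*" if "x \<in> fst H" "y \<in> fst H" for x y
    using H(3) that unfolding connected_graph_def by blast
  obtain x where "x \<in> fst H" using H(3) unfolding connected_graph_def by blast
  then obtain y where xy: "sg_adj H x y" using connected_has_nbr[OF H(1,3,2,4)] by blast
  then have "x \<noteq> y" using subgraph_adj(3)[OF H(1) xy] cay_irrefl by auto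
  have n: "real (card (fst H)) > 0" using H(4) by simp
  show ?thesis
    unfolding lowest_nonzero_eig_def
  proof (rule cInf_greatest)
    show "{ev. ev \<noteq> 0 \<and> is_eigenvalue LapN (card S) (fst H) (sg_adj H) ev} \<noteq> {}"
      using g.neumann_nonzero_eigenvalue_exists[OF H(2) xy \<open>x \<noteq> y\<close>] by blast
    fix ev assume "ev \<in> {ev. ev \<noteq> 0 \<and> is_eigenvalue LapN (card S) (fst H) (sg_adj H) ev}"
    then have "1 \<le> 2 * (real (card (fst H)))\<^sup>2 * ev"
      using g.neumann_eigenvalue_ge[OF H(2) conn] by blast
    then show "1 / (2 * (real (card (fst H)))\<^sup>2) \<le> ev"
      using n by (simp add: divide_le_eq mult.commute)
  qed
qed

text \<open>Balls are finite, so an infinite group has a point outside the ball of radius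
  \<open>L\<close>. A shortest chain from the identity to it has more than \<open>L\<close> steps,
  and its first \<open>L\<close> vertices induce a path.\<close>

lemma geodesic_path:
  assumes inf: "infinite (carrier G)"
  obtains f :: "nat \<Rightarrow> 'a" where "inj_on f {..<L}" "f ` {..<L} \<subseteq> carrier G"
    "\<And>i j. i < L \<Longrightarrow> j < L \<Longrightarrow> cay G S (f i) (f j) \<longleftrightarrow> j = Suc i \<or> i = Suc j"
proof -
  interpret cg: bounded_degree_graph "carrier G" "cay G S" "card S" by (rule bounded_degree_cay)
  have "\<not> carrier G \<subseteq> cg.graph_ball \<one> L"
    using inf finite_subset[OF _ cg.finite_graph_ball] by blast
  then obtain z where z: "z \<in> carrier G" "z \<notin> cg.graph_ball \<one> L" by blast
  have "(\<one>, z) \<in> {(u, v). cay G S u v}\<^sup>*" using cay_reachable[OF z(1) one_closed] z(1) by simp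
  then obtain n f where f: "f 0 = \<one>" "f n = z" "\<And>i. i < n \<Longrightarrow> (f i, f (Suc i)) \<in> {(u, v). cay G S u v}"
    "\<And>i j. i < j \<Longrightarrow> j \<le> n \<Longrightarrow> f i \<noteq> f j"
    "\<And>i j. i < j \<Longrightarrow> j \<le> n \<Longrightarrow> (f i, f j) \<in> {(u, v). cay G S u v} \<Longrightarrow> j = Suc i"
    by (rule shortest_chain) (rule that)
  have ball: "f i \<in> cg.graph_ball \<one> i" if "i \<le> n" for i
    using that
  proof (induction i)
    case (Suc i)
    then show ?case using f(3)[of i] by auto
  qed (simp add: f)
  have nL: "n > L"
  proof (rule ccontr)
    assume "\<not> n > L"
    then show False using ball[of n] cg.graph_ball_mono[of n L \<one>] z(2) f(2) by auto
  qed
  show ?thesis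
  proof (rule that)
    show "inj_on f {..<L}" by (rule linorder_inj_onI) (use f(4) nL in auto)
    show "f ` {..<L} \<subseteq> carrier G"
    proof (rule image_subsetI)
      fix i assume "i \<in> {..<L}"
      then have "cay G S (f i) (f (Suc i))" using f(3)[of i] nL by simp
      then show "f i \<in> carrier G" by (rule cay_carrier)
    qed
    fix i j assume ij: "i < L" "j < L"
    have step: "cay G S (f i) (f (Suc i))" if "i < L" for i using f(3)[of i] that nL by simp
    have less: "j = Suc i" if "cay G S (f i) (f j)" "i < j" "j < L" for i j
      using f(5)[of i j] that nL by simp
    show "cay G S (f i) (f j) \<longleftrightarrow> j = Suc i \<or> i = Suc j"
    proof
      assume c: "cay G S (f i) (f j)"
      then have "i \<noteq> j" using cay_irrefl by auto
      then show "j = Suc i \<or> i = Suc j" using less[OF c] less[OF cay_sym[OF c]] ij by linarith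
    next
      assume "j = Suc i \<or> i = Suc j"
      then show "cay G S (f i) (f j)" using step[of i] step[of j] ij cay_sym by auto
    qed
  qed
qed

lemma path_neumann_eigenvalue:
  assumes L: "L \<ge> 2" and inj: "inj_on f {..<L}"
    and adj: "\<And>i j. i < L \<Longrightarrow> j < L \<Longrightarrow> cay G S (f i) (f j) \<longleftrightarrow> j = Suc i \<or> i = Suc j"
  shows "is_eigenvalue LapN (card S) (f ` {..<L}) (cay G S) (2 - 2 * cos (pi / real L))"
proof -
  define c where "c j = cos (pi / real L * (real j + 1 / 2))" for j
  define \<phi> where "\<phi> y = c (inv_into {..<L} f y)" for y
  have \<phi>: "\<phi> (f i) = c i" if "i < L" for i
    using inj that by (simp add: \<phi>_def inv_into_f_f)
  have "lapop LapN (card S) (f ` {..<L}) (cay G S) \<phi> (f i) = (2 - 2 * cos (pi / real L)) * \<phi> (f i)"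
    if i: "i < L" for i
  proof -
    define N where "N = {j. j < L \<and> (j = Suc i \<or> i = Suc j)}"
    have "{y \<in> f ` {..<L}. cay G S (f i) y} = f ` N" using adj[OF i] by (auto simp: N_def)
    moreover have "inj_on f N" by (rule inj_on_subset[OF inj]) (auto simp: N_def)
    ultimately have "gdeg (f ` {..<L}) (cay G S) (f i) = real (card N)"
      "adjop (f ` {..<L}) (cay G S) \<phi> (f i) = (\<Sum>j\<in>N. c j)"
      by (auto simp: gdeg_def adjop_def card_image sum.reindex \<phi> N_def intro!: sum.cong)
    then show ?thesis
      using i path_neumann_sum[OF i] by (simp add: lapop_def \<phi> N_def c_def)
  qed
  \<comment> \<open>This value is cos(pi / (2 L)); it certifies that the eigenvector is not
    zero.\<close>
  moreover have "c 0 > 0"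
  proof -
    have "0 < pi / real L * (0 + 1 / 2)" "pi / real L * (0 + 1 / 2) < pi / 2"
      using L by (auto simp: field_simps)
    then show ?thesis unfolding c_def by (simp only: of_nat_0 cos_gt_zero)
  qed
  then have "f 0 \<in> f ` {..<L}" "\<phi> (f 0) \<noteq> 0" using L by (auto simp: \<phi>)
  ultimately show ?thesis unfolding is_eigenvalue_def by blast
qed

lemma cluster_exists:
  assumes inf: "infinite (carrier G)" and H: "finite_connected_subgraph G S H" "card (fst H) \<ge> 2"
    and E: "lowest_nonzero_eig t (card S) H \<le> E"
  obtains K lam where "finite K" "K \<subseteq> carrier G" "\<And>x. x \<in> K \<Longrightarrow> \<exists>y\<in>K. cay G S x y"
    "is_eigenvalue t (card S) K (cay G S) lam" "0 < lam" "lam \<le> E" "0 < card K" "card K \<le> 6 * card (fst H)"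
proof (cases "t = LapN")
  case False
  have H': "subgraph G S H" "finite (fst H)" "connected_graph H" "fst H \<noteq> {}"
    using H(1) by (auto simp: finite_connected_subgraph_def connected_graph_def)
  obtain lam where lam: "0 < lam" "lam \<le> lowest_nonzero_eig t (card S) H"
    "is_eigenvalue t (card S) (fst H) (cay G S) lam"
    using induced_eigenvalue_le_lowest[OF inf False H'(1,2,4)] .
  show ?thesis
  proof (rule that[of "fst H" lam])
    show "\<exists>y\<in>fst H. cay G S x y" if "x \<in> fst H" for x
      using connected_has_nbr[OF H'(1,3,2) H(2) that] subgraph_adj(3)[OF H'(1)] by blast
    show "fst H \<subseteq> carrier G" using H'(1) by (simp add: subgraph_def)
  qed (use lam E H' H(2) in auto)
next
  case True
  define n where "n = card (fst H)"
  \<comment> \<open>Bounding pi by 4, the comparison (4/L)^2 <= 1/(2 n^2) needs L^2 >= 32 n^2, and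
    6^2 = 36.\<close>
  define L where "L = 6 * n"
  have n: "n \<ge> 2" using H(2) by (simp add: n_def)
  have L2: "L \<ge> 2" using n by (simp add: L_def)
  obtain f :: "nat \<Rightarrow> 'a" where f: "inj_on f {..<L}" "f ` {..<L} \<subseteq> carrier G"
    "\<And>i j. i < L \<Longrightarrow> j < L \<Longrightarrow> cay G S (f i) (f j) \<longleftrightarrow> j = Suc i \<or> i = Suc j"
    by (rule geodesic_path[OF inf, where L = L]) (rule that)
  define lam where "lam = 2 - 2 * cos (pi / real L)"
  have "lam \<le> (pi / real L)\<^sup>2" unfolding lam_def by (rule two_minus_two_cos_le)
  also have "\<dots> \<le> (4 / real L)\<^sup>2"
    using pi_less_4 by (intro power_mono divide_right_mono) auto
  also have "\<dots> \<le> 1 / (2 * (real n)\<^sup>2)"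
    using n by (simp add: L_def field_simps power2_eq_square)
  also have "\<dots> \<le> lowest_nonzero_eig t (card S) H"
    using lowest_neumann_ge[of H] H True by (simp add: n_def finite_connected_subgraph_def)
  finally have lam_E: "lam \<le> E" using E by linarith
  have "cos (pi / real L) < cos 0"
    using L2 by (intro cos_monotone_0_pi) (auto simp: divide_le_eq)
  then have lam0: "lam > 0" by (simp add: lam_def)
  show ?thesis
  proof (rule that[of "f ` {..<L}" lam])
    show "\<exists>y\<in>f ` {..<L}. cay G S x y" if x: "x \<in> f ` {..<L}" for x
    proof -
      obtain i where i: "i < L" "x = f i" using x by auto
      define j where "j = (if Suc i < L then Suc i else i - 1)"
      have "j < L" "j = Suc i \<or> i = Suc j" using i L2 by (auto simp: j_def)
      then show ?thesis using f(3)[of i j] i by auto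
    qed
    show "is_eigenvalue t (card S) (f ` {..<L}) (cay G S) lam"
      unfolding True lam_def by (rule path_neumann_eigenvalue[OF L2 f(1,3)])
    have "card (f ` {..<L}) = L" using card_image[OF f(1)] by simp
    then show "0 < card (f ` {..<L})" "card (f ` {..<L}) \<le> 6 * card (fst H)"
      using L2 by (simp_all add: L_def n_def)
  qed (use f lam0 lam_E in auto)
qed

end

section \<open>Assembling the constants\<close>

theorem theorem3p4:
  fixes G :: "('a, 'b) monoid_scheme" and S :: "'a set"
    and t :: lap_type and pt :: perc_type
    and H :: "nat \<Rightarrow> 'a set \<times> 'a set set" and c :: "nat \<Rightarrow> real"
  assumes "group G" and "fin_gen_set G S" and "amenable G"
    and "\<And>n. finite_connected_subgraph G S (H n)"
    and "\<And>n. c n > 0"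
    and "filterlim (\<lambda>n. card (fst (H n))) at_top sequentially"
    and "c \<longlonglongrightarrow> 0"
    and "\<And>n. lowest_nonzero_eig t (card S) (H n) \<le> c n"
  shows "\<forall>p. 0 < p \<and> p < 1 \<longrightarrow>
           (\<exists>b>0. \<exists>E0>0. \<forall>E. 0 < E \<and> E < E0 \<longrightarrow>
              IDS pt t G S p E - IDS pt t G S p 0
                \<ge> exp (- b * real (card (fst (H (LEAST n. c n \<le> E))))))"
proof (intro allI impI)
  fix p :: real
  assume p: "0 < p \<and> p < 1"
  interpret cayley_graph G S
    using assms(1,2) by (simp add: cayley_graph_def cayley_graph_axioms_def)
  have inf: "infinite (carrier G)"
  proof
    assume fin: "finite (carrier G)"
    have "card (fst (H n)) \<le> card (carrier G)" for n
      using assms(4)[of n] fin by (intro card_mono) (auto simp: finite_connected_subgraph_def subgraph_def)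
    moreover obtain n where "card (fst (H n)) \<ge> Suc (card (carrier G))"
      using assms(6) by (metis (mono_tags, lifting) eventually_happens' filterlim_at_top sequentially_bot)
    ultimately show False by (metis not_less_eq_eq)
  qed
  define r where "r = min p (1 - p)"
  have r: "0 < r" "r < 1" using p by (auto simp: r_def)
  \<comment> \<open>The summand 6 pays for the factor 1/|K|, through exp(-6 n) <= 1/(6 n). The other
    summand is the cost of the cluster event, with |K| <= 6 n.\<close>
  define b where "b = 6 + 6 * real (Suc (card S)) * (- ln r)"
  have "b > 0" unfolding b_def using r by (intro add_pos_nonneg mult_nonneg_nonneg) auto
  obtain N where N: "\<And>n. n \<ge> N \<Longrightarrow> card (fst (H n)) \<ge> 2"
    using assms(6) unfolding filterlim_at_top eventually_sequentially by blast
  \<comment> \<open>Below \<open>E0\<close> no index smaller than \<open>N\<close> satisfies c n <=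
    E, so the least such index is at least \<open>N\<close>. Inserting 1 covers the case N =
    0.\<close>
  define E0 where "E0 = Min (insert 1 (c ` {..<N}))"
  have "E0 > 0" unfolding E0_def using assms(5) by (subst Min_gr_iff) auto
  have "IDS pt t G S p E - IDS pt t G S p 0 \<ge> exp (- b * real (card (fst (H (LEAST n. c n \<le> E)))))"
    if E: "0 < E" "E < E0" for E
  proof -
    define m where "m = (LEAST n. c n \<le> E)"
    have "\<exists>n. c n \<le> E"
      using order_tendstoD(2)[OF assms(7) E(1)] by (auto simp: eventually_sequentially intro: less_imp_le)
    then have cm: "c m \<le> E" unfolding m_def by (rule LeastI_ex)
    have "m \<ge> N"
    proof (rule ccontr)
      assume "\<not> m \<ge> N"
      then have "E0 \<le> c m" unfolding E0_def by (intro Min_le) auto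
      then show False using cm E by simp
    qed
    then have n2: "card (fst (H m)) \<ge> 2" by (rule N)
    define n where "n = card (fst (H m))"
    have "lowest_nonzero_eig t (card S) (H m) \<le> E" using assms(8)[of m] cm by linarith
    then obtain K lam where K: "finite K" "K \<subseteq> carrier G" "\<And>x. x \<in> K \<Longrightarrow> \<exists>y\<in>K. cay G S x y"
      "is_eigenvalue t (card S) K (cay G S) lam" "0 < lam" "lam \<le> E" "0 < card K" "card K \<le> 6 * n"
      by (rule cluster_exists[OF inf assms(4) n2, folded n_def]) (rule that)
    have "exp (- b * real n) = exp (- (6 * real n)) * exp (real (Suc (card S) * (6 * n)) * ln r)"
      by (simp add: b_def algebra_simps flip: exp_add)
    also have "exp (real (Suc (card S) * (6 * n)) * ln r) = r ^ (Suc (card S) * (6 * n))"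
      using r by (simp only: exp_of_nat_mult exp_ln)
    also have "exp (- (6 * real n)) \<le> 1 / (6 * real n)"
    proof -
      have "6 * real n \<le> exp (6 * real n)" using exp_ge_add_one_self[of "6 * real n"] by linarith
      then show ?thesis using n2 by (simp add: exp_minus n_def field_simps)
    qed
    \<comment> \<open>Both factors decrease as |K| grows, so replacing |K| by its bound 6 n only
      loses.\<close>
    also have "1 / (6 * real n) * r ^ (Suc (card S) * (6 * n)) \<le> 1 / real (card K) * r ^ (Suc (card S) * card K)"
      using K(7,8) r by (intro mult_mono power_decreasing frac_le mult_le_mono2) auto
    also have "\<dots> \<le> IDS pt t G S p E - IDS pt t G S p 0"
      unfolding r_def using p K by (intro IDS_gap_of_cluster) auto
    finally show ?thesis using r by (simp add: n_def m_def)
  qed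
  with \<open>b > 0\<close> \<open>E0 > 0\<close> show "\<exists>b>0. \<exists>E0>0. \<forall>E. 0 < E \<and> E < E0 \<longrightarrow>
      IDS pt t G S p E - IDS pt t G S p 0 \<ge> exp (- b * real (card (fst (H (LEAST n. c n \<le> E)))))"
    by blast
qed

end
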